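(* Let $R$ be an $F$-finite Noetherian commutative ring of prime characteristic $p$, let $\mathcal D$ be a Cartier subalgebra on $R$, and let $\mathcal U_{\mathcal D}\subseteq \operatorname{Spec} R$ be the $F$-pure locus of the pair $(R,\mathcal D)$. Then the Cartier core map $$\mathcal U_{\mathcal D}\to \operatorname{Spec} R,\qquad P\mapsto C_{\mathcal D}(P)$$ is a well-defined, continuous (for the Zariski topology), containment preserving map (if $P_1\subseteq P_2$ then $C_{\mathcal D}(P_1)\subseteq C_{\mathcal D}(P_2)$) on $\mathcal U_{\mathcal D}$ which fixes the $\mathcal D$-compatible ideals (if $P\in\mathcal U_{\mathcal D}$ is $\mathcal D$-compatible then $C_{\mathcal D}(P)=P$). The image of this map is the set of prime $\mathcal D$-compatible ideals lying in $\mathcal U_{\mathcal D}$, and it is always finite. The image is the set of minimal primes of $R$ precisely when the pair $(R,\mathcal D)$ is strongly $F$-regular.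
   Context: For a ring $R$ of prime characteristic $p$, $F_*^eR=\{F_*^e r : r\in R\}$ denotes $R$ viewed as an $R$-module via the $e$-th iterate of Frobenius: $r\,F_*^e s=F_*^e(r^{p^e}s)$ (and $F_*^0R=R$). $R$ is $F$-finite if $F_*R$ is a finitely generated $R$-module. The full Cartier algebra is the graded noncommutative ring $\mathcal C_R=\bigoplus_{e\ge 0}\operatorname{Hom}_R(F_*^eR,R)$ with multiplication, for $\phi$ of degree $e$ and $\psi$ of degree $d$, given by $(\phi\cdot\psi)(F_*^{e+d}r)=\phi\big(F_*^e(\psi(F_*^d r))\big)$. A Cartier subalgebra $\mathcal D=\bigoplus_e\mathcal D_e$ is a graded subalgebra of $\mathcal C_R$ with $\mathcal D_0=\operatorname{Hom}_R(R,R)=R$. The pair $(R,\mathcal D)$ is $F$-pure (Frobenius split) if there are $e>0$ and $\phi\in\mathcal D_e$ with $\phi(F_*^e1)=1$. For $c\in R$ it is $F$-pure along $c$ if there are $e>0$ and $\phi\in\mathcal D_e$ with $\phi(F_*^ec)=1$. It is strongly $F$-regular if it is $F$-pure along every $c\in R$ that lies in no minimal prime of $R$. For a prime $P$, $\mathcal D_P$ is the Cartier subalgebra on $R_P$ with $(\mathcal D_P)_e=R_P\otimes_R\mathcal D_e\subseteq\operatorname{Hom}_{R_P}(F_*^e(R_P),R_P)$ (using $R_P\otimes_R\operatorname{Hom}_R(F_*^eR,R)\cong\operatorname{Hom}_{R_P}(F_*^e(R_P),R_P)$). The $F$-pure locus $\mathcal U_{\mathcal D}$ is the set of primes $P$ such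 that $(R_P,\mathcal D_P)$ is $F$-pure, with the subspace topology. For an ideal $J$ of $R$, the Cartier core is $C_{\mathcal D}(J)=\{r\in R : \phi(F_*^e r)\in J \text{ for all } e>0 \text{ and all } \phi\in\mathcal D_e\}$. An ideal $J$ is $\mathcal D$-compatible if $\phi(F_*^e(J))\subseteq J$ for all $e$ and all $\phi\in\mathcal D_e$.
   Formalization: The last sentence is proved as: (R,D) is strongly F-regular iff (R,D) is F-pure and the image is the set of minimal primes; without F-purity the converse fails, e.g. R=F_p[x], D_e=x·Hom(F_*^e R,R) for e>0. *)

theory Defs
  imports "HOL-Algebra.Algebra" "HOL-Analysis.Abstract_Topology"
begin

section \<open>Prime spectrum\<close>

definition Spec :: "('a, 'm) ring_scheme \<Rightarrow> 'a set set" where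
  "Spec R = {P. primeideal P R}"

definition minimal_primes :: "('a, 'm) ring_scheme \<Rightarrow> 'a set set" where
  "minimal_primes R = {P \<in> Spec R. \<forall>Q \<in> Spec R. Q \<subseteq> P \<longrightarrow> Q = P}"

definition zero_locus :: "('a, 'm) ring_scheme \<Rightarrow> 'a set \<Rightarrow> 'a set set" where
  "zero_locus R E = {P \<in> Spec R. E \<subseteq> P}"

definition zariski :: "('a, 'm) ring_scheme \<Rightarrow> 'a set topology" where
  "zariski R = topology (\<lambda>U. \<exists>E \<subseteq> carrier R. U = Spec R - zero_locus R E)"

lemma istopology_zariski:
  "istopology (\<lambda>U. \<exists>E \<subseteq> carrier R. U = Spec R - zero_locus R E)"
  unfolding istopology_def
proof (intro conjI allI impI)
  fix U V
  assume "\<exists>E \<subseteq> carrier R. U = Spec R - zero_locus R E"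
    and "\<exists>E \<subseteq> carrier R. V = Spec R - zero_locus R E"
  then obtain E F where E: "E \<subseteq> carrier R" "U = Spec R - zero_locus R E"
    and F: "F \<subseteq> carrier R" "V = Spec R - zero_locus R F" by blast
  let ?G = "{a \<otimes>\<^bsub>R\<^esub> b | a b. a \<in> E \<and> b \<in> F}"
  have *: "?G \<subseteq> P \<longleftrightarrow> E \<subseteq> P \<or> F \<subseteq> P" if "P \<in> Spec R" for P
  proof -
    interpret primeideal P R using that by (simp add: Spec_def)
    have "a \<otimes>\<^bsub>R\<^esub> b \<in> P \<longleftrightarrow> a \<in> P \<or> b \<in> P" if "a \<in> E" "b \<in> F" for a b
    proof -
      have "a \<in> carrier R" "b \<in> carrier R" using that E(1) F(1) by auto
      then show ?thesis using I_prime I_l_closed I_r_closed by metis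
    qed
    then show ?thesis by blast
  qed
  have UV: "U \<inter> V = Spec R - zero_locus R ?G"
  proof (rule Set.set_eqI)
    fix P
    show "P \<in> U \<inter> V \<longleftrightarrow> P \<in> Spec R - zero_locus R ?G"
      unfolding E(2) F(2) zero_locus_def Int_iff Diff_iff mem_Collect_eq
      using *[of P] by argo
  qed
  show "\<exists>E \<subseteq> carrier R. U \<inter> V = Spec R - zero_locus R E"
  proof (cases "Spec R = {}")
    case True
    then show ?thesis using E by (intro exI[of _ E]) simp
  next
    case False
    then obtain P where "primeideal P R" by (auto simp: Spec_def)
    then interpret primeideal P R .
    have "?G \<subseteq> carrier R" using E(1) F(1) by blast
    then show ?thesis using UV by (intro exI[of _ ?G] conjI)
  qed
next
  fix K
  assume "\<forall>U\<in>K. \<exists>E \<subseteq> carrier R. U = Spec R - zero_locus R E"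
  then obtain E where E: "\<And>U. U \<in> K \<Longrightarrow> E U \<subseteq> carrier R \<and> U = Spec R - zero_locus R (E U)"
    by metis
  have "\<Union>K = Spec R - zero_locus R (\<Union>U\<in>K. E U)"
  proof (rule Set.set_eqI)
    fix P
    have "P \<in> U \<longleftrightarrow> P \<in> Spec R \<and> \<not> E U \<subseteq> P" if "U \<in> K" for U
      using E[OF that] unfolding zero_locus_def by auto
    then show "P \<in> \<Union>K \<longleftrightarrow> P \<in> Spec R - zero_locus R (\<Union>U\<in>K. E U)"
      unfolding zero_locus_def by auto
  qed
  moreover have "(\<Union>U\<in>K. E U) \<subseteq> carrier R"
    using E by (simp add: UN_subset_iff)
  ultimately show "\<exists>E \<subseteq> carrier R. \<Union>K = Spec R - zero_locus R E"
    by (intro exI[of _ "\<Union>U\<in>K. E U"] conjI)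
qed

lemma openin_zariski:
  "openin (zariski R) U \<longleftrightarrow> (\<exists>E \<subseteq> carrier R. U = Spec R - zero_locus R E)"
  unfolding zariski_def by (simp add: topology_inverse' istopology_zariski)


section \<open>Characteristic, Frobenius pushforwards and F-finiteness\<close>

definition has_char :: "('a, 'm) ring_scheme \<Rightarrow> nat \<Rightarrow> bool" where
  "has_char R p \<longleftrightarrow> (\<forall>n::nat. [n] \<cdot>\<^bsub>R\<^esub> \<one>\<^bsub>R\<^esub> = \<zero>\<^bsub>R\<^esub> \<longleftrightarrow> p dvd n)"

text \<open>\<open>F\<^sub>*\<^sup>e R\<close>, with the elements \<open>F\<^sub>*\<^sup>e r\<close> and \<open>r\<close> identified.\<close>

definition Frob :: "('a, 'm) ring_scheme \<Rightarrow> nat \<Rightarrow> nat \<Rightarrow> ('a, 'a) module" where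
  "Frob R p e = \<lparr>carrier = carrier R, monoid.mult = monoid.mult R, monoid.one = \<one>\<^bsub>R\<^esub>,
     ring.zero = \<zero>\<^bsub>R\<^esub>, ring.add = ring.add R,
     smult = (\<lambda>r s. (r [^]\<^bsub>R\<^esub> (p ^ e)) \<otimes>\<^bsub>R\<^esub> s)\<rparr>"

definition fg_module :: "('a, 'm) ring_scheme \<Rightarrow> ('a, 'b, 'n) module_scheme \<Rightarrow> bool" where
  "fg_module R M \<longleftrightarrow> (\<exists>A. finite A \<and> A \<subseteq> carrier M \<and>
     (\<forall>x \<in> carrier M. \<exists>c \<in> A \<rightarrow> carrier R. x = (\<Oplus>\<^bsub>M\<^esub>a\<in>A. c a \<odot>\<^bsub>M\<^esub> a)))"

definition F_finite :: "('a, 'm) ring_scheme \<Rightarrow> nat \<Rightarrow> bool" where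
  "F_finite R p \<longleftrightarrow> fg_module R (Frob R p 1)"


section \<open>Cartier subalgebras\<close>

definition module_homs ::
  "('a, 'm) ring_scheme \<Rightarrow> ('a, 'b, 'n) module_scheme \<Rightarrow> ('a, 'c, 'k) module_scheme \<Rightarrow> ('b \<Rightarrow> 'c) set"
  where
  "module_homs R M N = {f \<in> carrier M \<rightarrow>\<^sub>E carrier N.
     (\<forall>x \<in> carrier M. \<forall>y \<in> carrier M. f (x \<oplus>\<^bsub>M\<^esub> y) = f x \<oplus>\<^bsub>N\<^esub> f y) \<and>
     (\<forall>r \<in> carrier R. \<forall>x \<in> carrier M. f (r \<odot>\<^bsub>M\<^esub> x) = r \<odot>\<^bsub>N\<^esub> f x)}"

text \<open>The additive group \<open>Hom\<^sub>R(F\<^sub>*\<^sup>e R, R)\<close>, the component of degree \<open>e\<close> of the full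
  Cartier algebra. The target \<open>R\<close> is \<open>F\<^sub>*\<^sup>0 R\<close>.\<close>

definition cartier_group :: "('a, 'm) ring_scheme \<Rightarrow> nat \<Rightarrow> nat \<Rightarrow> ('a \<Rightarrow> 'a) monoid" where
  "cartier_group R p e = \<lparr>carrier = module_homs R (Frob R p e) (Frob R p 0),
     monoid.mult = (\<lambda>\<phi> \<psi>. \<lambda>x \<in> carrier R. \<phi> x \<oplus>\<^bsub>R\<^esub> \<psi> x),
     monoid.one = (\<lambda>x \<in> carrier R. \<zero>\<^bsub>R\<^esub>)\<rparr>"

text \<open>A graded subalgebra is given by its family of homogeneous components. Under the
  identification of \<open>F\<^sub>*\<^sup>e r\<close> with \<open>r\<close> the product of homogeneous elements is composition.\<close>

definition cartier_subalgebra ::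
  "('a, 'm) ring_scheme \<Rightarrow> nat \<Rightarrow> (nat \<Rightarrow> ('a \<Rightarrow> 'a) set) \<Rightarrow> bool" where
  "cartier_subalgebra R p D \<longleftrightarrow>
     (\<forall>e. subgroup (D e) (cartier_group R p e)) \<and>
     D 0 = carrier (cartier_group R p 0) \<and>
     (\<forall>e d. \<forall>\<phi> \<in> D e. \<forall>\<psi> \<in> D d. compose (carrier R) \<phi> \<psi> \<in> D (e + d))"

definition F_pure_along ::
  "('a, 'm) ring_scheme \<Rightarrow> (nat \<Rightarrow> ('a \<Rightarrow> 'a) set) \<Rightarrow> 'a \<Rightarrow> bool" where
  "F_pure_along R D c \<longleftrightarrow> (\<exists>e > 0. \<exists>\<phi> \<in> D e. \<phi> c = \<one>\<^bsub>R\<^esub>)"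

definition F_pure :: "('a, 'm) ring_scheme \<Rightarrow> (nat \<Rightarrow> ('a \<Rightarrow> 'a) set) \<Rightarrow> bool" where
  "F_pure R D \<longleftrightarrow> (\<exists>e > 0. \<exists>\<phi> \<in> D e. \<phi> \<one>\<^bsub>R\<^esub> = \<one>\<^bsub>R\<^esub>)"

definition strongly_F_regular ::
  "('a, 'm) ring_scheme \<Rightarrow> (nat \<Rightarrow> ('a \<Rightarrow> 'a) set) \<Rightarrow> bool" where
  "strongly_F_regular R D \<longleftrightarrow>
     (\<forall>c \<in> carrier R. (\<forall>P \<in> minimal_primes R. c \<notin> P) \<longrightarrow> F_pure_along R D c)"

definition cartier_core ::
  "('a, 'm) ring_scheme \<Rightarrow> (nat \<Rightarrow> ('a \<Rightarrow> 'a) set) \<Rightarrow> 'a set \<Rightarrow> 'a set" where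
  "cartier_core R D J = {r \<in> carrier R. \<forall>e > 0. \<forall>\<phi> \<in> D e. \<phi> r \<in> J}"

definition D_compatible ::
  "('a, 'm) ring_scheme \<Rightarrow> (nat \<Rightarrow> ('a \<Rightarrow> 'a) set) \<Rightarrow> 'a set \<Rightarrow> bool" where
  "D_compatible R D J \<longleftrightarrow> ideal J R \<and> (\<forall>e. \<forall>\<phi> \<in> D e. \<phi> ` J \<subseteq> J)"


section \<open>Localization\<close>

definition loc_rel :: "('a, 'm) ring_scheme \<Rightarrow> 'a set \<Rightarrow> (('a \<times> 'a) \<times> ('a \<times> 'a)) set" where
  "loc_rel R S = {((r, s), (r', s')). r \<in> carrier R \<and> s \<in> S \<and> r' \<in> carrier R \<and> s' \<in> S \<and>
     (\<exists>u \<in> S. u \<otimes>\<^bsub>R\<^esub> (r \<otimes>\<^bsub>R\<^esub> s') = u \<otimes>\<^bsub>R\<^esub> (r' \<otimes>\<^bsub>R\<^esub> s))}"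

definition loc_frac :: "('a, 'm) ring_scheme \<Rightarrow> 'a set \<Rightarrow> 'a \<Rightarrow> 'a \<Rightarrow> ('a \<times> 'a) set" where
  "loc_frac R S r s = loc_rel R S `` {(r, s)}"

text \<open>\<open>S\<^sup>-\<^sup>1R\<close> for a multiplicative set \<open>S\<close>. The unions are over sets that all coincide,
  because the operations respect \<open>loc_rel\<close>.\<close>

definition localization :: "('a, 'm) ring_scheme \<Rightarrow> 'a set \<Rightarrow> ('a \<times> 'a) set ring" where
  "localization R S = \<lparr>carrier = (carrier R \<times> S) // loc_rel R S,
     monoid.mult = (\<lambda>A B. \<Union>(r, s) \<in> A. \<Union>(r', s') \<in> B. loc_frac R S (r \<otimes>\<^bsub>R\<^esub> r') (s \<otimes>\<^bsub>R\<^esub> s')),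
     monoid.one = loc_frac R S \<one>\<^bsub>R\<^esub> \<one>\<^bsub>R\<^esub>,
     ring.zero = loc_frac R S \<zero>\<^bsub>R\<^esub> \<one>\<^bsub>R\<^esub>,
     ring.add = (\<lambda>A B. \<Union>(r, s) \<in> A. \<Union>(r', s') \<in> B.
       loc_frac R S ((r \<otimes>\<^bsub>R\<^esub> s') \<oplus>\<^bsub>R\<^esub> (r' \<otimes>\<^bsub>R\<^esub> s)) (s \<otimes>\<^bsub>R\<^esub> s'))\<rparr>"

definition local_ring :: "('a, 'm) ring_scheme \<Rightarrow> 'a set \<Rightarrow> ('a \<times> 'a) set ring" where
  "local_ring R P = localization R (carrier R - P)"

text \<open>The map \<open>F\<^sub>*\<^sup>e(R\<^sub>P) \<rightarrow> R\<^sub>P\<close> induced by \<open>\<phi> : F\<^sub>*\<^sup>e R \<rightarrow> R\<close>. With \<open>q = p\<^sup>e\<close>, linearity over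
  \<open>R\<^sub>P\<close> and \<open>r/s = s\<^sup>q\<^sup>-\<^sup>1r / s\<^sup>q\<close> force \<open>F\<^sub>*\<^sup>e(r/s) = (1/s) F\<^sub>*\<^sup>e(s\<^sup>q\<^sup>-\<^sup>1r/1) \<mapsto> \<phi>(F\<^sub>*\<^sup>e(s\<^sup>q\<^sup>-\<^sup>1r)) / s\<close>.\<close>

definition loc_map ::
  "('a, 'm) ring_scheme \<Rightarrow> nat \<Rightarrow> 'a set \<Rightarrow> nat \<Rightarrow> ('a \<Rightarrow> 'a) \<Rightarrow> ('a \<times> 'a) set \<Rightarrow> ('a \<times> 'a) set"
  where
  "loc_map R p P e \<phi> = (\<lambda>A \<in> carrier (local_ring R P).
     \<Union>(r, s) \<in> A. loc_frac R (carrier R - P) (\<phi> ((s [^]\<^bsub>R\<^esub> (p ^ e - 1)) \<otimes>\<^bsub>R\<^esub> r)) s)"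

text \<open>The image of \<open>R\<^sub>P \<otimes>\<^sub>R D\<^sub>e\<close> in \<open>Hom(F\<^sub>*\<^sup>e(R\<^sub>P), R\<^sub>P)\<close>: the additive group generated by
  the images \<open>a \<cdot> \<phi>\<^sub>P\<close> of the simple tensors \<open>a \<otimes> \<phi>\<close>.\<close>

definition cartier_localization ::
  "('a, 'm) ring_scheme \<Rightarrow> nat \<Rightarrow> (nat \<Rightarrow> ('a \<Rightarrow> 'a) set) \<Rightarrow> 'a set \<Rightarrow>
     nat \<Rightarrow> (('a \<times> 'a) set \<Rightarrow> ('a \<times> 'a) set) set" where
  "cartier_localization R p D P e = generate (cartier_group (local_ring R P) p e)
     {(\<lambda>A \<in> carrier (local_ring R P). a \<otimes>\<^bsub>local_ring R P\<^esub> loc_map R p P e \<phi> A) | a \<phi>.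
        a \<in> carrier (local_ring R P) \<and> \<phi> \<in> D e}"

definition F_pure_locus ::
  "('a, 'm) ring_scheme \<Rightarrow> nat \<Rightarrow> (nat \<Rightarrow> ('a \<Rightarrow> 'a) set) \<Rightarrow> 'a set set" where
  "F_pure_locus R p D =
     {P \<in> Spec R. F_pure (local_ring R P) (cartier_localization R p D P)}"

end

theory Submission
  imports Defs
begin

text \<open>
  All statements about the core map rest on one translation: \<open>P\<close> is in the F-pure locus if and only
  if some \<open>\<phi>\<close> of positive degree in \<open>D\<close> has \<open>\<phi>(1) \<notin> P\<close> (\<open>F_pure_locus_iff\<close>). Given that, most of the
  theorem is a direct computation with the rule \<open>\<phi>(r\<^sup>q x) = r \<phi>(x)\<close> for \<open>q = p\<^sup>e\<close>: the core of \<open>P\<close> is a compatible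
  ideal contained in \<open>P\<close> (\<open>core_compatible\<close>, \<open>core_subset\<close>), it is prime (\<open>core_prime\<close>), and it contains
  a set \<open>E\<close> precisely when \<open>P\<close> contains all the \<open>\<phi>(r)\<close> for \<open>r\<close> in \<open>E\<close> and \<open>\<phi>\<close> of positive degree
  (\<open>core_continuous\<close>). The image therefore consists of the compatible primes in the locus.

  The substance is the finiteness of this image (\<open>finite_compatible_primes\<close>). By Noetherian induction
  it suffices to find, for a compatible prime \<open>Q\<close> in the locus, one element \<open>c\<close> outside \<open>Q\<close> which
  lies in every compatible prime strictly above \<open>Q\<close>. Fix \<open>\<phi>\<close> of degree \<open>e > 0\<close> with \<open>\<phi>(1) \<notin> Q\<close>. In
  the domain \<open>R/Q\<close> the pairing \<open>(x, y) \<mapsto> \<phi>(x y)\<close> is nondegenerate, because \<open>\<phi>(x\<^sup>q\<^sup>-\<^sup>1 x) = x \<phi>(1)\<close>.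
  As \<open>R\<close> is finite over its \<open>q\<close>-th powers, dual bases exist after inverting an element, that is,
  there are \<open>c \<notin> Q\<close> and finitely many \<open>x\<^sub>i\<close>, \<open>y\<^sub>i\<close> with \<open>c\<^sup>q h \<equiv> \<Sum>\<^sub>i \<phi>(y\<^sub>i h)\<^sup>q x\<^sub>i\<close> modulo \<open>Q\<close> for all
  \<open>h\<close> (\<open>trace_operator_scalar\<close>). For \<open>h\<close> in a compatible prime \<open>P\<close> the right-hand side is in \<open>P\<^sup>2\<close>. So
  if \<open>c \<notin> P\<close>, then \<open>P = P\<^sup>2 + Q\<close> locally at \<open>P\<close>, and Nakayama's lemma gives \<open>P = Q\<close>
  (\<open>element_in_larger_compatible_primes\<close>). The sum is built up one generator of
  \<open>R\<close> at a time.

  For the last claim, strong F-regularity implies that a compatible prime contains only elements of the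
  union of the minimal primes, and prime avoidance applies because there are finitely many of these.
  In the other direction, an element \<open>c\<close> that no map sends to 1 lies in the core of some prime
  (\<open>prime_core_containing_nonsplit_element\<close>), and so in a minimal prime.
\<close>

section \<open>Ideals in commutative and Noetherian rings\<close>

lemma (in cring) ideal_of_closed:
  assumes "I \<subseteq> carrier R" "\<zero> \<in> I"
    and add: "\<And>a b. a \<in> I \<Longrightarrow> b \<in> I \<Longrightarrow> a \<oplus> b \<in> I"
    and mult: "\<And>a x. a \<in> I \<Longrightarrow> x \<in> carrier R \<Longrightarrow> x \<otimes> a \<in> I"
  shows "ideal I R"
proof (rule idealI[OF ring_axioms])
  have "\<ominus> a \<in> I" if "a \<in> I" for a
  proof -
    have "\<ominus> a = \<ominus> \<one> \<otimes> a" using that assms(1) by (simp add: l_minus subset_iff)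
    with mult[OF that, of "\<ominus> \<one>"] show ?thesis by simp
  qed
  then show "subgroup I (add_monoid R)"
    using assms by unfold_locales (auto simp: a_inv_def[symmetric] intro: add)
  show "a \<otimes> x \<in> I" if "a \<in> I" "x \<in> carrier R" for a x
    using mult[OF that] assms(1) that by (metis m_comm subsetD)
qed (use mult in auto)

lemma (in ring) ideal_add_cancel:
  assumes "ideal I R" "a \<in> carrier R" "b \<in> I" "a \<oplus> b \<in> I"
  shows "a \<in> I"
proof -
  interpret I: ideal I R by fact
  have "\<ominus> \<one> \<otimes> b \<in> I" using assms(3) by (simp add: I.I_l_closed)
  then have "(a \<oplus> b) \<ominus> b \<in> I"
    using assms(3,4) I.a_Hcarr by (simp add: minus_eq l_minus I.a_closed)
  moreover have "(a \<oplus> b) \<ominus> b = a" using assms(2,3) I.a_Hcarr by (simp add: minus_eq a_assoc r_neg)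
  ultimately show ?thesis by simp
qed

text \<open>Noetherian induction in the form in which it is used below: Zorn's lemma applies because the
  union of a nonempty chain of ideals is already a member of the chain.\<close>

lemma (in noetherian_ring) maximal_member_of_ideals:
  assumes "\<F> \<noteq> {}" "\<And>I. I \<in> \<F> \<Longrightarrow> ideal I R"
  obtains M where "M \<in> \<F>" "\<And>I. I \<in> \<F> \<Longrightarrow> M \<subseteq> I \<Longrightarrow> I = M"
proof -
  have "\<Union>C \<in> \<F>" if "C \<noteq> {}" "subset.chain \<F> C" for C
  proof -
    have "subset.chain {I. ideal I R} C"
      using that(2) assms(2) unfolding subset.chain_def by blast
    from ideal_chain_is_trivial[OF that(1) this] show ?thesis
      using that(2) unfolding subset.chain_def by blast
  qed
  from subset_Zorn_nonempty[OF assms(1) this] show ?thesis using that by metis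
qed

lemma (in noetherian_ring) prime_containing_proper_ideal:
  assumes "cring R" "ideal I R" "\<one> \<notin> I"
  obtains P where "primeideal P R" "I \<subseteq> P"
proof -
  interpret cring R by fact
  let ?F = "{J. ideal J R \<and> I \<subseteq> J \<and> \<one> \<notin> J}"
  have "?F \<noteq> {}" using assms by blast
  then obtain M where M: "M \<in> ?F" and max: "\<And>J. J \<in> ?F \<Longrightarrow> M \<subseteq> J \<Longrightarrow> J = M"
    using maximal_member_of_ideals[of ?F] by blast
  have "maximalideal M R"
  proof (rule maximalidealI)
    show "ideal M R" using M by blast
    show "carrier R \<noteq> M" using M one_closed by blast
    fix J assume J: "ideal J R" "M \<subseteq> J" "J \<subseteq> carrier R"
    then show "J = M \<or> J = carrier R"
      using max[of J] M ideal.one_imp_carrier[OF J(1)] by blast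
  qed
  from maximalideal_prime[OF this] M that show ?thesis by blast
qed

text \<open>The product of one element from each ideal, all chosen outside \<open>P\<close>, stays outside \<open>P\<close>.\<close>

lemma (in cring) common_element_outside_prime:
  assumes "finite \<I>" "\<And>I. I \<in> \<I> \<Longrightarrow> ideal I R \<and> \<not> I \<subseteq> P" "primeideal P R"
  shows "\<exists>d \<in> carrier R. (\<forall>I \<in> \<I>. d \<in> I) \<and> d \<notin> P"
  using assms(1,2)
proof (induction rule: finite_induct)
  case empty
  then show ?case
    using assms(3) primeideal.I_notcarr[OF assms(3)] ideal.one_imp_carrier[of P R]
      primeideal.axioms(1)[OF assms(3)] by auto
next
  case (insert I F)
  then obtain d where d: "d \<in> carrier R" "\<forall>I \<in> F. d \<in> I" "d \<notin> P" by blast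
  obtain x where x: "x \<in> I" "x \<notin> P" using insert.prems by blast
  have xc: "x \<in> carrier R" using x(1) insert.prems[of I] ideal.Icarr[of I R] by simp
  have "d \<otimes> x \<in> J" if "J \<in> insert I F" for J
    using that insert.prems[OF that] d x xc ideal.I_l_closed[of J R] ideal.I_r_closed[of J R] by auto
  moreover have "d \<otimes> x \<notin> P" using primeideal.I_prime[OF assms(3)] d x xc by blast
  ultimately show ?case using d xc by (intro bexI[of _ "d \<otimes> x"]) auto
qed

text \<open>Prime avoidance. Incomparability, which holds for minimal primes, makes the induction short: an
  element \<open>c\<close> that avoids all primes but \<open>P\<close> can be corrected by some \<open>d\<close> that lies in \<open>Q\<close> and in
  all the other primes but not in \<open>P\<close>.\<close>

lemma (in cring) avoid_incomparable_primes:
  assumes "finite \<P>" "\<And>P. P \<in> \<P> \<Longrightarrow> primeideal P R"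
    and "\<And>P P'. P \<in> \<P> \<Longrightarrow> P' \<in> \<P> \<Longrightarrow> P' \<subseteq> P \<Longrightarrow> P' = P"
    and Q: "ideal Q R" "\<And>P. P \<in> \<P> \<Longrightarrow> \<not> Q \<subseteq> P"
  shows "\<exists>c \<in> Q. \<forall>P \<in> \<P>. c \<notin> P"
  using assms(1-3) Q(2)
proof (induction rule: finite_induct)
  case empty
  then show ?case using additive_subgroup.zero_closed[OF ideal.axioms(1)[OF Q(1)]] by blast
next
  case (insert P F)
  then obtain c where c: "c \<in> Q" "\<forall>P \<in> F. c \<notin> P" by (metis insertCI)
  show ?case
  proof (cases "c \<in> P")
    case False
    with c show ?thesis by blast
  next
    case True
    have "\<exists>d \<in> carrier R. (\<forall>I \<in> insert Q F. d \<in> I) \<and> d \<notin> P"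
    proof (rule common_element_outside_prime)
      show "finite (insert Q F)" using insert.hyps by simp
      show "ideal I R \<and> \<not> I \<subseteq> P" if "I \<in> insert Q F" for I
      proof (cases "I = Q")
        case False
        with that have "I \<in> F" by blast
        then have "\<not> I \<subseteq> P" using insert.prems(2)[of P I] insert.hyps(2) by blast
        with \<open>I \<in> F\<close> show ?thesis using insert.prems(1)[of I] primeideal.axioms(1) by blast
      qed (use Q insert.prems(3) in blast)
      show "primeideal P R" using insert.prems(1) by blast
    qed
    then obtain d where d: "d \<in> carrier R" "\<forall>I \<in> insert Q F. d \<in> I" "d \<notin> P" by blast
    have cc: "c \<in> carrier R" using c(1) ideal.Icarr[OF Q(1)] by blast
    have "c \<oplus> d \<in> Q"
      using c(1) d(2) additive_subgroup.a_closed[OF ideal.axioms(1)[OF Q(1)]] by blast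
    moreover have "c \<oplus> d \<notin> P'" if "P' \<in> F" for P'
    proof
      assume "c \<oplus> d \<in> P'"
      then have "c \<in> P'"
        using ideal_add_cancel[of P' c d] insert.prems(1)[of P'] primeideal.axioms(1) cc d(2) that by blast
      then show False using c(2) that by blast
    qed
    moreover have "c \<oplus> d \<notin> P"
    proof
      assume "c \<oplus> d \<in> P"
      then have "d \<in> P"
        using ideal_add_cancel[of P d c] insert.prems(1)[of P] primeideal.axioms(1) cc d(1) True
        by (metis a_comm insertI1)
      then show False using d(3) by blast
    qed
    ultimately show ?thesis by blast
  qed
qed

text \<open>One step of Nakayama's lemma at the prime \<open>P\<close>, phrased with denominators instead of in the
  localization. The hypothesis on \<open>w\<close> says \<open>P = P\<^sup>2 + Q\<close> locally at \<open>P\<close>. If locally \<open>P\<close> is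
  generated by \<open>f\<close> together with \<open>J\<close>, then \<open>f \<in> P f + J\<close> locally, so \<open>f\<close> times a unit lies in \<open>J\<close>
  and the generator \<open>f\<close> is superfluous.\<close>

lemma (in cring) nakayama_step:
  assumes P: "primeideal P R" and J: "ideal J R" "Q \<subseteq> J"
    and w: "w \<in> carrier R - P" "\<And>x. x \<in> P \<Longrightarrow> \<exists>q \<in> Q. \<exists>y \<in> P \<cdot> P. w \<otimes> x = y \<oplus> q"
    and f: "f \<in> P"
    and v: "v \<in> carrier R - P" "\<And>x. x \<in> P \<Longrightarrow> v \<otimes> x \<in> PIdl f <+>\<^bsub>R\<^esub> J"
  shows "\<exists>v \<in> carrier R - P. \<forall>x \<in> P. v \<otimes> x \<in> J"
proof -
  interpret P: primeideal P R by fact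
  interpret J: ideal J R by fact
  have fc: "f \<in> carrier R" using f P.Icarr by blast
  have rep: "\<exists>r \<in> carrier R. \<exists>j \<in> J. v \<otimes> x = r \<otimes> f \<oplus> j" if "x \<in> P" for x
    using v(2)[OF that] unfolding set_add_def' cgenideal_def by auto
  have prod: "\<exists>a \<in> P. \<exists>j \<in> J. v \<otimes> y = a \<otimes> f \<oplus> j" if "y \<in> P \<cdot> P" for y
    using that
  proof (induction rule: ideal_prod.induct)
    case (prod a b)
    obtain r j where rj: "r \<in> carrier R" "j \<in> J" "v \<otimes> b = r \<otimes> f \<oplus> j" using rep[OF prod(2)] by blast
    have c: "a \<in> carrier R" "b \<in> carrier R" "j \<in> carrier R" using prod rj(2) P.Icarr J.Icarr by auto
    have "v \<otimes> (a \<otimes> b) = a \<otimes> (v \<otimes> b)" using c v(1) by (simp add: m_lcomm)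
    also have "\<dots> = (a \<otimes> r) \<otimes> f \<oplus> a \<otimes> j" using c rj fc by (simp add: r_distr m_assoc)
    finally show ?case using P.I_r_closed[OF prod(1) rj(1)] J.I_l_closed[OF rj(2) c(1)] by blast
  next
    case (sum s t)
    obtain a j b k where *: "a \<in> P" "j \<in> J" "v \<otimes> s = a \<otimes> f \<oplus> j" "b \<in> P" "k \<in> J" "v \<otimes> t = b \<otimes> f \<oplus> k"
      using sum.IH by blast
    have c: "a \<in> carrier R" "b \<in> carrier R" "j \<in> carrier R" "k \<in> carrier R" 
      using * P.Icarr J.Icarr by auto
    have "s \<in> carrier R" "t \<in> carrier R"
      using sum.hyps ideal_prod_in_carrier[OF P.is_ideal P.is_ideal] by auto
    then have "v \<otimes> (s \<oplus> t) = (a \<oplus> b) \<otimes> f \<oplus> (j \<oplus> k)"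
      using c v(1) fc * by (simp add: r_distr l_distr a_ac)
    then show ?case using * P.a_closed J.a_closed by blast
  qed
  obtain q y where qy: "q \<in> Q" "y \<in> P \<cdot> P" "w \<otimes> f = y \<oplus> q" using w(2)[OF f] by blast
  obtain a j where aj: "a \<in> P" "j \<in> J" "v \<otimes> y = a \<otimes> f \<oplus> j" using prod[OF qy(2)] by blast
  have c: "y \<in> carrier R" "q \<in> carrier R" "a \<in> carrier R" "j \<in> carrier R" "w \<in> carrier R" "v \<in> carrier R"
    using qy aj ideal_prod_in_carrier[OF P.is_ideal P.is_ideal] J(2) J.Icarr P.Icarr w v by auto
  \<comment> \<open>The determinant trick for the single generator \<open>f\<close>: \<open>u\<close> is \<open>w v\<close> modulo \<open>P\<close>.\<close>
  let ?u = "w \<otimes> v \<ominus> a"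
  have "?u \<otimes> f = v \<otimes> (w \<otimes> f) \<ominus> a \<otimes> f"
    using c fc by (simp add: minus_eq r_distr r_minus m_ac)
  also have "v \<otimes> (w \<otimes> f) = (j \<oplus> v \<otimes> q) \<oplus> a \<otimes> f"
    using c fc by (simp add: qy(3) r_distr aj(3) a_ac)
  also have "(j \<oplus> v \<otimes> q) \<oplus> a \<otimes> f \<ominus> a \<otimes> f = j \<oplus> v \<otimes> q"
    using c fc by (simp add: minus_eq a_assoc r_neg)
  finally have uf: "?u \<otimes> f \<in> J"
    using aj(2) qy(1) J c(6) by (simp add: J.a_closed J.I_l_closed subset_iff)
  have wv: "w \<otimes> v \<notin> P" using P.I_prime[of w v] w(1) v(1) by blast
  have uP: "?u \<notin> P"
    using ideal_add_cancel[OF P.is_ideal, of "w \<otimes> v" "\<ominus> a"] wv aj(1) c by (auto simp: minus_eq)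
  have uc: "?u \<in> carrier R" using c by simp
  have "(?u \<otimes> v) \<otimes> x \<in> J" if "x \<in> P" for x
  proof -
    obtain r k where rk: "r \<in> carrier R" "k \<in> J" "v \<otimes> x = r \<otimes> f \<oplus> k" using rep[OF \<open>x \<in> P\<close>] by blast
    have xk: "x \<in> carrier R" "k \<in> carrier R" using that rk P.Icarr J.Icarr by auto
    have "(?u \<otimes> v) \<otimes> x = ?u \<otimes> (r \<otimes> f \<oplus> k)" using xk c uc rk(3) by (simp add: m_assoc)
    also have "\<dots> = r \<otimes> (?u \<otimes> f) \<oplus> ?u \<otimes> k"
      using uc xk(2) rk(1) fc by (simp add: r_distr m_lcomm)
    finally show ?thesis using uf rk uc by (simp add: J.a_closed J.I_l_closed)
  qed
  moreover have "?u \<otimes> v \<in> carrier R - P" using P.I_prime[of ?u v] uP v(1) uc by auto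
  ultimately show ?thesis by blast
qed

text \<open>If \<open>P = P\<^sup>2 + Q\<close> locally at \<open>P\<close>, then dropping the finitely many generators of \<open>P\<close> one at a
  time leaves \<open>P = Q\<close> locally at \<open>P\<close>; as \<open>Q\<close> is prime, this is an equality in \<open>R\<close>.\<close>

lemma (in noetherian_ring) prime_eq_of_localized_idempotent:
  assumes "cring R" and P: "primeideal P R" and Q: "primeideal Q R" "Q \<subseteq> P"
    and w: "w \<in> carrier R - P" "\<And>x. x \<in> P \<Longrightarrow> \<exists>q \<in> Q. \<exists>y \<in> P \<cdot> P. w \<otimes> x = y \<oplus> q"
  shows "P = Q"
proof -
  interpret cring R by fact
  interpret P: primeideal P R by fact
  interpret Q: primeideal Q R by fact
  have elim: "\<exists>v \<in> carrier R - P. \<forall>x \<in> P. v \<otimes> x \<in> J"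
    if "finite F" "F \<subseteq> P" "ideal J R" "Q \<subseteq> J" "\<exists>v \<in> carrier R - P. \<forall>x \<in> P. v \<otimes> x \<in> Idl (F \<union> J)" for F J
    using that
  proof (induction F arbitrary: J rule: finite_induct)
    case empty
    then show ?case using genideal_minimal[of J J] by auto
  next
    case (insert f F)
    have Jc: "J \<subseteq> carrier R" using ideal.Icarr[OF insert.prems(2)] by blast
    have Fc: "F \<subseteq> carrier R" "f \<in> carrier R" using insert.prems(1) P.Icarr by auto
    let ?J = "Idl (F \<union> J)"
    have J: "ideal ?J R" "F \<union> J \<subseteq> ?J" using genideal_ideal[of "F \<union> J"] genideal_self[of "F \<union> J"] Jc Fc by blast+
    have Jc': "?J \<subseteq> carrier R" using ideal.Icarr[OF J(1)] by blast
    obtain v where v: "v \<in> carrier R - P" "\<And>x. x \<in> P \<Longrightarrow> v \<otimes> x \<in> Idl (insert f F \<union> J)"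
      using insert.prems(4) by blast
    have S: "ideal (PIdl f <+>\<^bsub>R\<^esub> ?J) R" using add_ideals[OF cgenideal_ideal[OF Fc(2)] J(1)] .
    have "insert f F \<union> J \<subseteq> PIdl f <+>\<^bsub>R\<^esub> ?J"
    proof
      fix x assume x: "x \<in> insert f F \<union> J"
      show "x \<in> PIdl f <+>\<^bsub>R\<^esub> ?J"
      proof (cases "x = f")
        case True
        then show ?thesis
          using cgenideal_self[OF Fc(2)] additive_subgroup.zero_closed[OF ideal.axioms(1)[OF J(1)]] Fc(2)
          unfolding set_add_def' by (metis (mono_tags, lifting) UN_I insertI1 r_zero)
      next
        case False
        with x J(2) have "x \<in> ?J" by blast
        moreover have "\<zero> \<in> PIdl f"
          using additive_subgroup.zero_closed[OF ideal.axioms(1)[OF cgenideal_ideal[OF Fc(2)]]] .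
        moreover have "x = \<zero> \<oplus> x" using \<open>x \<in> ?J\<close> Jc' by auto
        ultimately show ?thesis unfolding set_add_def' by blast
      qed
    qed
    from genideal_minimal[OF S this] v(2)
    have v': "\<And>x. x \<in> P \<Longrightarrow> v \<otimes> x \<in> PIdl f <+>\<^bsub>R\<^esub> ?J" by (meson subsetD)
    have "f \<in> P" "Q \<subseteq> ?J" using insert.prems(1,3) J(2) by auto
    then have "\<exists>v \<in> carrier R - P. \<forall>x \<in> P. v \<otimes> x \<in> ?J"
      using nakayama_step[OF P J(1) _ w _ v(1) v'] by simp
    then show ?case using insert.IH[of J] insert.prems(1-3) by simp
  qed
  obtain F where F: "F \<subseteq> carrier R" "finite F" "P = Idl F" using finetely_gen[OF P.is_ideal] by blast
  have FP: "F \<subseteq> P" using genideal_self[OF F(1)] F(3) by blast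
  have "P \<subseteq> Idl (F \<union> Q)"
    using F(1,3) Q.Icarr subset_Idl_subset[of "F \<union> Q" F] by blast
  moreover have "\<one> \<in> carrier R - P" using P.I_notcarr P.one_imp_carrier by blast
  ultimately have "\<exists>v \<in> carrier R - P. \<forall>x \<in> P. v \<otimes> x \<in> Idl (F \<union> Q)"
    using P.Icarr by (intro bexI[of _ \<one>]) auto
  from elim[OF F(2) FP Q.is_ideal _ this]
  \<comment> \<open>With all generators dropped, only \<open>Q\<close> is left.\<close>
  obtain v where v: "v \<in> carrier R - P" "\<forall>x \<in> P. v \<otimes> x \<in> Q" by blast
  have "x \<in> Q" if "x \<in> P" for x
    using Q.I_prime[of v x] P.Icarr[OF that] that Q(2) v by blast
  then have "P \<subseteq> Q" by blast
  with Q(2) show ?thesis by blast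
qed

section \<open>Frobenius\<close>

lemma (in cring) binomial_expansion:
  assumes "a \<in> carrier R" "b \<in> carrier R"
  shows "(a \<oplus> b) [^] n = (\<Oplus>k\<in>{..n}. [(n choose k)] \<cdot> (a [^] k \<otimes> b [^] (n - k)))"
proof (induction n)
  case 0
  then show ?case using assms by (simp add: Pi_def)
next
  case (Suc n)
  let ?t = "\<lambda>k. [(n choose k)] \<cdot> (a [^] k \<otimes> b [^] (n - k))"
  let ?A = "\<lambda>k. if k = 0 then \<zero> else [(n choose (k - 1))] \<cdot> (a [^] k \<otimes> b [^] (Suc n - k))"
  let ?B = "\<lambda>k. [(n choose k)] \<cdot> (a [^] k \<otimes> b [^] (Suc n - k))"
  have t: "?t \<in> {..n} \<rightarrow> carrier R" and A: "?A \<in> UNIV \<rightarrow> carrier R" and B: "?B \<in> UNIV \<rightarrow> carrier R"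
    using assms by (auto simp: add.nat_pow_closed)
  have "a \<otimes> (\<Oplus>k\<in>{..n}. ?t k) = (\<Oplus>k\<in>{..n}. a \<otimes> ?t k)"
    using assms t by (intro finsum_rdistr) auto
  also have "\<dots> = (\<Oplus>k\<in>{..n}. ?A (Suc k))"
    using assms by (intro add.finprod_cong') (auto simp: add_pow_rdistr m_ac)
  also have "\<dots> = (\<Oplus>k\<in>{..Suc n}. ?A k)"
  proof -
    have "(\<Oplus>k\<in>{..Suc n}. ?A k) = (\<Oplus>k\<in>{..n}. ?A (Suc k)) \<oplus> ?A 0"
      using A by (intro finsum_Suc2) auto
    also have "\<dots> = (\<Oplus>k\<in>{..n}. ?A (Suc k))"
      using A assms by (auto intro!: r_zero finsum_closed)
    finally show ?thesis by simp
  qed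
  finally have 1: "a \<otimes> (\<Oplus>k\<in>{..n}. ?t k) = (\<Oplus>k\<in>{..Suc n}. ?A k)" .
  have "b \<otimes> (\<Oplus>k\<in>{..n}. ?t k) = (\<Oplus>k\<in>{..n}. b \<otimes> ?t k)"
    using assms t by (intro finsum_rdistr) auto
  also have "\<dots> = (\<Oplus>k\<in>{..n}. ?B k)"
    using assms by (intro add.finprod_cong') (auto simp: add_pow_rdistr m_ac Suc_diff_le)
  also have "\<dots> = (\<Oplus>k\<in>{..Suc n}. ?B k)"
  proof -
    have "(\<Oplus>k\<in>{..Suc n}. ?B k) = ?B (Suc n) \<oplus> (\<Oplus>k\<in>{..n}. ?B k)"
      using B by (intro finsum_Suc) auto
    moreover have "(\<Oplus>k\<in>{..n}. ?B k) \<in> carrier R" using B by (auto intro!: finsum_closed)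
    ultimately show ?thesis using assms by (simp add: binomial_eq_0)
  qed
  finally have 2: "b \<otimes> (\<Oplus>k\<in>{..n}. ?t k) = (\<Oplus>k\<in>{..Suc n}. ?B k)" .
  have "(a \<oplus> b) [^] Suc n = (a \<oplus> b) \<otimes> (\<Oplus>k\<in>{..n}. ?t k)"
    using assms Suc by (simp add: m_comm)
  also have "\<dots> = (\<Oplus>k\<in>{..Suc n}. ?A k) \<oplus> (\<Oplus>k\<in>{..Suc n}. ?B k)"
    using assms t unfolding 1[symmetric] 2[symmetric] by (intro l_distr) (auto intro!: finsum_closed)
  also have "\<dots> = (\<Oplus>k\<in>{..Suc n}. ?A k \<oplus> ?B k)"
    using A B by (intro finsum_addf[symmetric]) auto
  also have "\<dots> = (\<Oplus>k\<in>{..Suc n}. [(Suc n choose k)] \<cdot> (a [^] k \<otimes> b [^] (Suc n - k)))"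
  proof (intro add.finprod_cong' refl)
    fix k assume "k \<in> {..Suc n}"
    show "?A k \<oplus> ?B k = [(Suc n choose k)] \<cdot> (a [^] k \<otimes> b [^] (Suc n - k))"
      using assms by (cases k) (auto simp: add.nat_pow_mult)
  qed (use assms in auto)
  finally show ?case .
qed

text \<open>The inner binomial coefficients are divisible by \<open>p\<close>, hence vanish in \<open>R\<close>.\<close>

lemma (in cring) frobenius_add:
  assumes "Factorial_Ring.prime (p::nat)" "has_char R p" "a \<in> carrier R" "b \<in> carrier R"
  shows "(a \<oplus> b) [^] p = a [^] p \<oplus> b [^] p"
proof -
  obtain n where n: "p = Suc n" using prime_gt_0_nat[OF assms(1)] by (cases p) auto
  let ?t = "\<lambda>k. [(p choose k)] \<cdot> (a [^] k \<otimes> b [^] (p - k))"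
  have t: "?t k \<in> carrier R" for k using assms by simp
  have z: "?t k = \<zero>" if "0 < k" "k < p" for k
  proof -
    have "p dvd (p choose k)" using that assms(1) by (intro dvd_choose_prime) auto
    then have "[(p choose k)] \<cdot> \<one> = \<zero>" using assms(2) unfolding has_char_def by blast
    moreover have "?t k = ([(p choose k)] \<cdot> \<one>) \<otimes> (a [^] k \<otimes> b [^] (p - k))"
      using assms by (simp add: add_pow_ldistr)
    ultimately show ?thesis using assms by simp
  qed
  have "(\<Oplus>k\<in>{..n}. ?t k) = (\<Oplus>k\<in>{..n}. if k = 0 then b [^] p else \<zero>)"
    using t z n assms by (intro add.finprod_cong') auto
  also have "\<dots> = b [^] p"
    using add.finprod_singleton[of 0 "{..n}" "\<lambda>_. b [^] p"] assms by (simp add: eq_commute[of 0])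
  finally have s: "(\<Oplus>k\<in>{..n}. ?t k) = b [^] p" .
  have "(a \<oplus> b) [^] p = (\<Oplus>k\<in>{..Suc n}. ?t k)"
    using binomial_expansion[OF assms(3,4), of p] n by simp
  also have "\<dots> = ?t (Suc n) \<oplus> (\<Oplus>k\<in>{..n}. ?t k)"
    using t by (intro finsum_Suc) auto
  finally show ?thesis using s assms n by simp
qed

lemma (in cring) frobenius_power_add:
  assumes "Factorial_Ring.prime (p::nat)" "has_char R p" "a \<in> carrier R" "b \<in> carrier R"
  shows "(a \<oplus> b) [^] (p ^ e) = a [^] (p ^ e) \<oplus> b [^] (p ^ e)"
proof (induction e)
  case (Suc e)
  have *: "x [^] (p ^ Suc e) = (x [^] (p ^ e)) [^] p" if "x \<in> carrier R" for x
    using that by (simp add: nat_pow_pow mult.commute)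
  show ?case using Suc assms by (simp add: * frobenius_add[OF assms(1,2)] del: power_Suc)
qed (use assms in simp)

section \<open>The group of Frobenius-linear maps\<close>

lemma (in cring) cartier_group_carrier_iff:
  "\<phi> \<in> carrier (cartier_group R p e) \<longleftrightarrow> \<phi> \<in> carrier R \<rightarrow>\<^sub>E carrier R \<and>
     (\<forall>x \<in> carrier R. \<forall>y \<in> carrier R. \<phi> (x \<oplus> y) = \<phi> x \<oplus> \<phi> y) \<and>
     (\<forall>r \<in> carrier R. \<forall>x \<in> carrier R. \<phi> (r [^] (p ^ e) \<otimes> x) = r \<otimes> \<phi> x)"
proof -
  have "r [^] (p ^ 0) = r" if "r \<in> carrier R" for r using that by simp
  then show ?thesis
    unfolding cartier_group_def module_homs_def Frob_def by (simp cong: ball_cong_simp)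
qed

lemma (in cring) cartier_groupI:
  assumes "\<And>x. x \<in> carrier R \<Longrightarrow> f x \<in> carrier R"
    and "\<And>x y. x \<in> carrier R \<Longrightarrow> y \<in> carrier R \<Longrightarrow> f (x \<oplus> y) = f x \<oplus> f y"
    and "\<And>r x. r \<in> carrier R \<Longrightarrow> x \<in> carrier R \<Longrightarrow> f (r [^] (p ^ e) \<otimes> x) = r \<otimes> f x"
  shows "(\<lambda>x \<in> carrier R. f x) \<in> carrier (cartier_group R p e)"
  unfolding cartier_group_carrier_iff
  by (intro conjI ballI restrict_PiE_iff[THEN iffD2]) (simp_all add: assms)

lemma (in cring) cartier_groupD:
  assumes "\<phi> \<in> carrier (cartier_group R p e)"
  shows "\<And>x. x \<in> carrier R \<Longrightarrow> \<phi> x \<in> carrier R"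
    and "\<And>x y. x \<in> carrier R \<Longrightarrow> y \<in> carrier R \<Longrightarrow> \<phi> (x \<oplus> y) = \<phi> x \<oplus> \<phi> y"
    and "\<And>r x. r \<in> carrier R \<Longrightarrow> x \<in> carrier R \<Longrightarrow> \<phi> (r [^] (p ^ e) \<otimes> x) = r \<otimes> \<phi> x"
    and "\<phi> \<in> extensional (carrier R)"
  using assms unfolding cartier_group_carrier_iff PiE_def by blast+

text \<open>The group axioms are what lets a localized Cartier algebra, defined as a generated subgroup
  including inverses, be bounded above by any subgroup that contains its generators.\<close>

lemma (in cring) cartier_group_is_group: "group (cartier_group R p e)"
proof (rule groupI)
  fix x y z
  assume x: "x \<in> carrier (cartier_group R p e)"
  note xD = cartier_groupD[OF x]
  show "\<one>\<^bsub>cartier_group R p e\<^esub> \<otimes>\<^bsub>cartier_group R p e\<^esub> x = x"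
    using xD(4) by (intro extensionalityI[of _ "carrier R"]) (simp_all add: cartier_group_def xD(1))
  have "(\<lambda>a \<in> carrier R. \<ominus> x a) \<in> carrier (cartier_group R p e)"
    by (rule cartier_groupI) (simp_all add: xD(1-3) minus_add r_minus)
  moreover have "(\<lambda>a \<in> carrier R. \<ominus> x a) \<otimes>\<^bsub>cartier_group R p e\<^esub> x = \<one>\<^bsub>cartier_group R p e\<^esub>"
    by (intro extensionalityI[of _ "carrier R"]) (simp_all add: cartier_group_def xD(1) l_neg)
  ultimately show "\<exists>y \<in> carrier (cartier_group R p e).
      y \<otimes>\<^bsub>cartier_group R p e\<^esub> x = \<one>\<^bsub>cartier_group R p e\<^esub>" by blast
  assume y: "y \<in> carrier (cartier_group R p e)"
  note yD = cartier_groupD[OF y]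
  have "(\<lambda>a \<in> carrier R. x a \<oplus> y a) \<in> carrier (cartier_group R p e)"
    by (rule cartier_groupI) (simp_all add: xD(1-3) yD(1-3) a_ac r_distr)
  then show "x \<otimes>\<^bsub>cartier_group R p e\<^esub> y \<in> carrier (cartier_group R p e)"
    by (simp add: cartier_group_def)
  assume z: "z \<in> carrier (cartier_group R p e)"
  note zD = cartier_groupD[OF z]
  show "x \<otimes>\<^bsub>cartier_group R p e\<^esub> y \<otimes>\<^bsub>cartier_group R p e\<^esub> z
      = x \<otimes>\<^bsub>cartier_group R p e\<^esub> (y \<otimes>\<^bsub>cartier_group R p e\<^esub> z)"
    by (intro extensionalityI[of _ "carrier R"])
      (simp_all add: cartier_group_def xD(1) yD(1) zD(1) a_assoc)
next
  have "(\<lambda>a \<in> carrier R. \<zero>) \<in> carrier (cartier_group R p e)"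
    by (rule cartier_groupI) simp_all
  then show "\<one>\<^bsub>cartier_group R p e\<^esub> \<in> carrier (cartier_group R p e)"
    by (simp add: cartier_group_def)
qed

lemma (in cring) cartier_group_scale:
  assumes "h \<in> carrier (cartier_group R p e)" "a \<in> carrier R"
  shows "(\<lambda>x \<in> carrier R. a \<otimes> h x) \<in> carrier (cartier_group R p e)"
  using assms(2)
  by (intro cartier_groupI) (simp_all add: cartier_groupD(1-3)[OF assms(1)] r_distr m_lcomm)

section \<open>Localization at a multiplicative set\<close>

locale mult_subset = cring R for R (structure) +
  fixes S
  assumes S_subset: "S \<subseteq> carrier R"
    and S_one: "\<one> \<in> S"
    and S_mult: "s \<in> S \<Longrightarrow> t \<in> S \<Longrightarrow> s \<otimes> t \<in> S"
begin

lemma S_carr: "s \<in> S \<Longrightarrow> s \<in> carrier R"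
  using S_subset by blast

lemma S_pow: "s \<in> S \<Longrightarrow> s [^] (n::nat) \<in> S"
  by (induction n) (auto intro: S_one S_mult)

abbreviation "L \<equiv> localization R S"
abbreviation "fraction \<equiv> loc_frac R S"

lemma loc_rel_iff:
  "((r, s), (r', s')) \<in> loc_rel R S \<longleftrightarrow> r \<in> carrier R \<and> s \<in> S \<and> r' \<in> carrier R \<and> s' \<in> S \<and>
     (\<exists>u \<in> S. u \<otimes> (r \<otimes> s') = u \<otimes> (r' \<otimes> s))"
  by (simp add: loc_rel_def)

lemma equiv_loc_rel: "equiv (carrier R \<times> S) (loc_rel R S)"
proof (rule equivI)
  show "loc_rel R S \<subseteq> (carrier R \<times> S) \<times> (carrier R \<times> S)" by (auto simp: loc_rel_def)
  show "refl_on (carrier R \<times> S) (loc_rel R S)"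
    using S_one by (auto simp: refl_on_def loc_rel_def)
  show "sym (loc_rel R S)"
    unfolding sym_def loc_rel_def by (auto, metis)
  show "trans (loc_rel R S)"
  proof (rule transI, clarify)
    fix r s r' s' r'' s''
    assume "((r, s), (r', s')) \<in> loc_rel R S" "((r', s'), (r'', s'')) \<in> loc_rel R S"
    then obtain u v where *: "r \<in> carrier R" "s \<in> S" "r' \<in> carrier R" "s' \<in> S" "r'' \<in> carrier R" "s'' \<in> S"
      "u \<in> S" "v \<in> S" "u \<otimes> (r \<otimes> s') = u \<otimes> (r' \<otimes> s)" "v \<otimes> (r' \<otimes> s'') = v \<otimes> (r'' \<otimes> s')"
      unfolding loc_rel_iff by blast
    note c = *(1,3,5) *(2,4,6-8)[THEN S_carr]
    have "(u \<otimes> v \<otimes> s') \<otimes> (r \<otimes> s'') = (v \<otimes> s'') \<otimes> (u \<otimes> (r \<otimes> s'))" using c by (simp add: m_ac)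
    also have "\<dots> = (u \<otimes> s) \<otimes> (v \<otimes> (r' \<otimes> s''))" unfolding *(9) using c by (simp add: m_ac)
    also have "\<dots> = (u \<otimes> v \<otimes> s') \<otimes> (r'' \<otimes> s)" unfolding *(10) using c by (simp add: m_ac)
    finally show "((r, s), (r'', s'')) \<in> loc_rel R S"
      using * S_mult unfolding loc_rel_iff by blast
  qed
qed

lemma frac_eq_iff:
  assumes "r \<in> carrier R" "s \<in> S" "r' \<in> carrier R" "s' \<in> S"
  shows "fraction r s = fraction r' s' \<longleftrightarrow> (\<exists>u \<in> S. u \<otimes> (r \<otimes> s') = u \<otimes> (r' \<otimes> s))"
  using eq_equiv_class_iff[OF equiv_loc_rel, of "(r, s)" "(r', s')"] assms
  unfolding loc_frac_def loc_rel_iff by simp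

lemma frac_eqI:
  assumes "r \<in> carrier R" "s \<in> S" "r' \<in> carrier R" "s' \<in> S" "r \<otimes> s' = r' \<otimes> s"
  shows "fraction r s = fraction r' s'"
  unfolding frac_eq_iff[OF assms(1-4)] assms(5) using S_one by blast

lemma mem_frac_iff:
  assumes "r \<in> carrier R" "s \<in> S"
  shows "(a, b) \<in> fraction r s \<longleftrightarrow> a \<in> carrier R \<and> b \<in> S \<and> fraction a b = fraction r s"
proof -
  have "(a, b) \<in> fraction r s \<longleftrightarrow> ((r, s), (a, b)) \<in> loc_rel R S" by (simp add: loc_frac_def)
  then show ?thesis
    using eq_equiv_class_iff[OF equiv_loc_rel, of "(r, s)" "(a, b)"] assms
    unfolding loc_frac_def loc_rel_iff by auto
qed

lemma carrier_L: "carrier L = {fraction r s | r s. r \<in> carrier R \<and> s \<in> S}"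
  by (auto simp: localization_def quotient_def loc_frac_def)

lemma frac_in_L [simp]: "r \<in> carrier R \<Longrightarrow> s \<in> S \<Longrightarrow> fraction r s \<in> carrier L"
  unfolding carrier_L by blast

lemma L_cases:
  assumes "A \<in> carrier L"
  obtains r s where "r \<in> carrier R" "s \<in> S" "A = fraction r s"
  using assms unfolding carrier_L by blast

text \<open>Operations on fractions are unions over all representatives. This evaluates such a union
  whenever its terms do not depend on the representative.\<close>

lemma UN_frac:
  assumes "r \<in> carrier R" "s \<in> S"
    and "\<And>a b. a \<in> carrier R \<Longrightarrow> b \<in> S \<Longrightarrow> fraction a b = fraction r s \<Longrightarrow> f a b = f r s"
  shows "(\<Union>(a, b) \<in> fraction r s. f a b) = f r s"
proof -
  have const: "f a b = f r s" if "(a, b) \<in> fraction r s" for a b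
    using that assms mem_frac_iff[OF assms(1,2)] by blast
  have rs: "(r, s) \<in> fraction r s" using assms(1,2) mem_frac_iff by blast
  show ?thesis
  proof (intro equalityI subsetI)
    fix x assume "x \<in> (\<Union>(a, b) \<in> fraction r s. f a b)"
    then obtain a b where "(a, b) \<in> fraction r s" "x \<in> f a b" by auto
    then show "x \<in> f r s" using const by blast
  next
    fix x assume "x \<in> f r s"
    then show "x \<in> (\<Union>(a, b) \<in> fraction r s. f a b)" by (intro UN_I[OF rs]) simp
  qed
qed

lemma mult_frac:
  assumes c: "r \<in> carrier R" "s \<in> S" "r' \<in> carrier R" "s' \<in> S"
  shows "fraction r s \<otimes>\<^bsub>L\<^esub> fraction r' s' = fraction (r \<otimes> r') (s \<otimes> s')"
proof -
  have *: "fraction (a \<otimes> a') (b \<otimes> b') = fraction (r \<otimes> r') (s \<otimes> s')"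
    if ab: "a \<in> carrier R" "b \<in> S" "fraction a b = fraction r s" "a' \<in> carrier R" "b' \<in> S" "fraction a' b' = fraction r' s'"
    for a b a' b'
  proof -
    obtain u v where uv: "u \<in> S" "u \<otimes> (a \<otimes> s) = u \<otimes> (r \<otimes> b)" "v \<in> S" "v \<otimes> (a' \<otimes> s') = v \<otimes> (r' \<otimes> b')"
      using ab(3,6) unfolding frac_eq_iff[OF ab(1,2) c(1,2)] frac_eq_iff[OF ab(4,5) c(3,4)] by blast
    note cc = c(1,3) ab(1,4) c(2,4)[THEN S_carr] ab(2,5)[THEN S_carr] uv(1,3)[THEN S_carr]
    have "(u \<otimes> v) \<otimes> ((a \<otimes> a') \<otimes> (s \<otimes> s')) = (u \<otimes> (a \<otimes> s)) \<otimes> (v \<otimes> (a' \<otimes> s'))"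
      using cc by (simp add: m_ac)
    also have "\<dots> = (u \<otimes> v) \<otimes> ((r \<otimes> r') \<otimes> (b \<otimes> b'))"
      unfolding uv(2,4) using cc by (simp add: m_ac)
    finally show ?thesis
      using cc c ab uv S_mult by (subst frac_eq_iff) blast+
  qed
  have "fraction r s \<otimes>\<^bsub>L\<^esub> fraction r' s' =
      (\<Union>(a, b) \<in> fraction r s. \<Union>(a', b') \<in> fraction r' s'. fraction (a \<otimes> a') (b \<otimes> b'))"
    by (simp add: localization_def)
  also have "\<dots> = (\<Union>(a, b) \<in> fraction r s. fraction (a \<otimes> r') (b \<otimes> s'))"
  proof (intro SUP_cong refl, clarify)
    fix a b assume "(a, b) \<in> fraction r s"
    then have ab: "a \<in> carrier R" "b \<in> S" "fraction a b = fraction r s" using mem_frac_iff[OF c(1,2)] by auto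
    show "(\<Union>(a', b') \<in> fraction r' s'. fraction (a \<otimes> a') (b \<otimes> b')) = fraction (a \<otimes> r') (b \<otimes> s')"
    proof (rule UN_frac[OF c(3,4)])
      fix a' b' assume "a' \<in> carrier R" "b' \<in> S" "fraction a' b' = fraction r' s'"
      then show "fraction (a \<otimes> a') (b \<otimes> b') = fraction (a \<otimes> r') (b \<otimes> s')"
        using *[OF ab] *[OF ab c(3,4) refl] by simp
    qed
  qed
  also have "\<dots> = fraction (r \<otimes> r') (s \<otimes> s')"
    using UN_frac[OF c(1,2), of "\<lambda>a b. fraction (a \<otimes> r') (b \<otimes> s')"] *[OF _ _ _ c(3,4) refl] by blast
  finally show ?thesis .
qed

lemma add_frac:
  assumes c: "r \<in> carrier R" "s \<in> S" "r' \<in> carrier R" "s' \<in> S"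
  shows "fraction r s \<oplus>\<^bsub>L\<^esub> fraction r' s' = fraction (r \<otimes> s' \<oplus> r' \<otimes> s) (s \<otimes> s')"
proof -
  have *: "fraction (a \<otimes> b' \<oplus> a' \<otimes> b) (b \<otimes> b') = fraction (r \<otimes> s' \<oplus> r' \<otimes> s) (s \<otimes> s')"
    if ab: "a \<in> carrier R" "b \<in> S" "fraction a b = fraction r s" "a' \<in> carrier R" "b' \<in> S" "fraction a' b' = fraction r' s'"
    for a b a' b'
  proof -
    obtain u v where uv: "u \<in> S" "u \<otimes> (a \<otimes> s) = u \<otimes> (r \<otimes> b)" "v \<in> S" "v \<otimes> (a' \<otimes> s') = v \<otimes> (r' \<otimes> b')"
      using ab(3,6) unfolding frac_eq_iff[OF ab(1,2) c(1,2)] frac_eq_iff[OF ab(4,5) c(3,4)] by blast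
    note cc = c(1,3) ab(1,4) c(2,4)[THEN S_carr] ab(2,5)[THEN S_carr] uv(1,3)[THEN S_carr]
    have "(u \<otimes> v) \<otimes> ((a \<otimes> b' \<oplus> a' \<otimes> b) \<otimes> (s \<otimes> s'))
        = (v \<otimes> (b' \<otimes> s')) \<otimes> (u \<otimes> (a \<otimes> s)) \<oplus> (u \<otimes> (b \<otimes> s)) \<otimes> (v \<otimes> (a' \<otimes> s'))"
      using cc by (simp add: l_distr r_distr m_ac)
    also have "\<dots> = (u \<otimes> v) \<otimes> ((r \<otimes> s' \<oplus> r' \<otimes> s) \<otimes> (b \<otimes> b'))"
      unfolding uv(2,4) using cc by (simp add: l_distr r_distr m_ac)
    finally show ?thesis
      using cc c ab uv S_mult by (subst frac_eq_iff) (blast intro: a_closed m_closed)+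
  qed
  have "fraction r s \<oplus>\<^bsub>L\<^esub> fraction r' s' =
      (\<Union>(a, b) \<in> fraction r s. \<Union>(a', b') \<in> fraction r' s'. fraction (a \<otimes> b' \<oplus> a' \<otimes> b) (b \<otimes> b'))"
    by (simp add: localization_def)
  also have "\<dots> = (\<Union>(a, b) \<in> fraction r s. fraction (a \<otimes> s' \<oplus> r' \<otimes> b) (b \<otimes> s'))"
  proof (intro SUP_cong refl, clarify)
    fix a b assume "(a, b) \<in> fraction r s"
    then have ab: "a \<in> carrier R" "b \<in> S" "fraction a b = fraction r s" using mem_frac_iff[OF c(1,2)] by auto
    show "(\<Union>(a', b') \<in> fraction r' s'. fraction (a \<otimes> b' \<oplus> a' \<otimes> b) (b \<otimes> b'))
        = fraction (a \<otimes> s' \<oplus> r' \<otimes> b) (b \<otimes> s')"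
    proof (rule UN_frac[OF c(3,4)])
      fix a' b' assume "a' \<in> carrier R" "b' \<in> S" "fraction a' b' = fraction r' s'"
      then show "fraction (a \<otimes> b' \<oplus> a' \<otimes> b) (b \<otimes> b') = fraction (a \<otimes> s' \<oplus> r' \<otimes> b) (b \<otimes> s')"
        using *[OF ab] *[OF ab c(3,4) refl] by simp
    qed
  qed
  also have "\<dots> = fraction (r \<otimes> s' \<oplus> r' \<otimes> s) (s \<otimes> s')"
    using UN_frac[OF c(1,2), of "\<lambda>a b. fraction (a \<otimes> s' \<oplus> r' \<otimes> b) (b \<otimes> s')"] *[OF _ _ _ c(3,4) refl] by blast
  finally show ?thesis .
qed

lemma one_L: "\<one>\<^bsub>L\<^esub> = fraction \<one> \<one>" and zero_L: "\<zero>\<^bsub>L\<^esub> = fraction \<zero> \<one>"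
  by (simp_all add: localization_def)

lemma cring_localization: "cring L"
proof (rule cringI)
  note simps = mult_frac add_frac one_L zero_L S_one S_mult
  show "abelian_group L"
  proof (rule abelian_groupI)
    fix x y z assume x: "x \<in> carrier L"
    then obtain r s where rs: "r \<in> carrier R" "s \<in> S" "x = fraction r s" by (rule L_cases)
    have s: "s \<in> carrier R" using rs S_carr by blast
    show "\<zero>\<^bsub>L\<^esub> \<oplus>\<^bsub>L\<^esub> x = x" using rs s by (simp add: simps)
    have "fraction (\<ominus> r) s \<oplus>\<^bsub>L\<^esub> x = fraction (\<ominus> r \<otimes> s \<oplus> r \<otimes> s) (s \<otimes> s)"
      using rs s by (simp add: simps)
    also have "\<dots> = \<zero>\<^bsub>L\<^esub>"
      unfolding zero_L using rs s S_one S_mult by (intro frac_eqI) (simp_all add: l_minus l_neg)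
    finally show "\<exists>y \<in> carrier L. y \<oplus>\<^bsub>L\<^esub> x = \<zero>\<^bsub>L\<^esub>"
      using rs by (intro bexI[of _ "fraction (\<ominus> r) s"]) auto
    assume y: "y \<in> carrier L"
    then obtain r' s' where rs': "r' \<in> carrier R" "s' \<in> S" "y = fraction r' s'" by (rule L_cases)
    have s': "s' \<in> carrier R" using rs' S_carr by blast
    show "x \<oplus>\<^bsub>L\<^esub> y \<in> carrier L" using rs rs' s s' by (simp add: simps)
    show "x \<oplus>\<^bsub>L\<^esub> y = y \<oplus>\<^bsub>L\<^esub> x" using rs rs' s s' by (simp add: simps a_comm m_comm)
    assume z: "z \<in> carrier L"
    then obtain r'' s'' where rs'': "r'' \<in> carrier R" "s'' \<in> S" "z = fraction r'' s''" by (rule L_cases)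
    have s'': "s'' \<in> carrier R" using rs'' S_carr by blast
    have "(r \<otimes> s' \<oplus> r' \<otimes> s) \<otimes> s'' \<oplus> r'' \<otimes> (s \<otimes> s')
        = r \<otimes> (s' \<otimes> s'') \<oplus> (r' \<otimes> s'' \<oplus> r'' \<otimes> s') \<otimes> s"
      using rs(1) rs'(1) rs''(1) s s' s'' by (simp add: l_distr r_distr m_ac a_assoc)
    then show "x \<oplus>\<^bsub>L\<^esub> y \<oplus>\<^bsub>L\<^esub> z = x \<oplus>\<^bsub>L\<^esub> (y \<oplus>\<^bsub>L\<^esub> z)"
      using rs rs' rs'' s s' s'' by (simp add: simps m_assoc)
  qed (simp add: simps)
  show "comm_monoid L"
  proof (rule comm_monoidI)
    fix x y z assume x: "x \<in> carrier L"
    then obtain r s where rs: "r \<in> carrier R" "s \<in> S" "x = fraction r s" by (rule L_cases)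
    have s: "s \<in> carrier R" using rs S_carr by blast
    show "\<one>\<^bsub>L\<^esub> \<otimes>\<^bsub>L\<^esub> x = x" using rs s by (simp add: simps)
    assume y: "y \<in> carrier L"
    then obtain r' s' where rs': "r' \<in> carrier R" "s' \<in> S" "y = fraction r' s'" by (rule L_cases)
    have s': "s' \<in> carrier R" using rs' S_carr by blast
    show "x \<otimes>\<^bsub>L\<^esub> y \<in> carrier L" using rs rs' by (simp add: simps)
    show "x \<otimes>\<^bsub>L\<^esub> y = y \<otimes>\<^bsub>L\<^esub> x" using rs rs' s s' by (simp add: simps m_comm)
    assume z: "z \<in> carrier L"
    then obtain r'' s'' where rs'': "r'' \<in> carrier R" "s'' \<in> S" "z = fraction r'' s''" by (rule L_cases)
    have s'': "s'' \<in> carrier R" using rs'' S_carr by blast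
    show "x \<otimes>\<^bsub>L\<^esub> y \<otimes>\<^bsub>L\<^esub> z = x \<otimes>\<^bsub>L\<^esub> (y \<otimes>\<^bsub>L\<^esub> z)"
      using rs rs' rs'' s s' s'' by (simp add: simps m_assoc)
  qed (simp_all add: simps)
  fix x y z assume x: "x \<in> carrier L" and y: "y \<in> carrier L" and z: "z \<in> carrier L"
  obtain r s where rs: "r \<in> carrier R" "s \<in> S" "x = fraction r s" using x by (rule L_cases)
  obtain r' s' where rs': "r' \<in> carrier R" "s' \<in> S" "y = fraction r' s'" using y by (rule L_cases)
  obtain r'' s'' where rs'': "r'' \<in> carrier R" "s'' \<in> S" "z = fraction r'' s''" using z by (rule L_cases)
  have c: "s \<in> carrier R" "s' \<in> carrier R" "s'' \<in> carrier R" using rs rs' rs'' S_carr by blast+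
  have "(x \<oplus>\<^bsub>L\<^esub> y) \<otimes>\<^bsub>L\<^esub> z = fraction ((r \<otimes> s' \<oplus> r' \<otimes> s) \<otimes> r'') (s \<otimes> s' \<otimes> s'')"
    using rs rs' rs'' c by (simp add: simps)
  also have "\<dots> = fraction (r \<otimes> r'' \<otimes> (s' \<otimes> s'') \<oplus> r' \<otimes> r'' \<otimes> (s \<otimes> s'')) (s \<otimes> s'' \<otimes> (s' \<otimes> s''))"
  proof (rule frac_eqI)
    show "(r \<otimes> s' \<oplus> r' \<otimes> s) \<otimes> r'' \<otimes> (s \<otimes> s'' \<otimes> (s' \<otimes> s'')) =
        (r \<otimes> r'' \<otimes> (s' \<otimes> s'') \<oplus> r' \<otimes> r'' \<otimes> (s \<otimes> s'')) \<otimes> (s \<otimes> s' \<otimes> s'')"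
      using rs(1) rs'(1) rs''(1) c by (simp add: l_distr r_distr m_ac)
  qed (use rs rs' rs'' c S_mult in auto)
  also have "\<dots> = x \<otimes>\<^bsub>L\<^esub> z \<oplus>\<^bsub>L\<^esub> y \<otimes>\<^bsub>L\<^esub> z"
    using rs rs' rs'' c by (simp add: simps)
  finally show "(x \<oplus>\<^bsub>L\<^esub> y) \<otimes>\<^bsub>L\<^esub> z = x \<otimes>\<^bsub>L\<^esub> z \<oplus>\<^bsub>L\<^esub> y \<otimes>\<^bsub>L\<^esub> z" .
qed

lemma pow_frac:
  assumes "r \<in> carrier R" "s \<in> S"
  shows "fraction r s [^]\<^bsub>L\<^esub> (n::nat) = fraction (r [^] n) (s [^] n)"
  using assms by (induction n) (simp_all add: one_L mult_frac S_pow)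

end

lemma (in primeideal) mult_subset_complement: "mult_subset R (carrier R - I)"
  using I_notcarr one_imp_carrier I_prime by unfold_locales auto

section \<open>Cartier subalgebras and the F-pure locus\<close>

locale cartier_algebra = cring R for R (structure) +
  fixes p :: nat and D :: "nat \<Rightarrow> ('a \<Rightarrow> 'a) set"
  assumes p_pos: "p > 0" and subalgebra: "cartier_subalgebra R p D"
begin

lemma D_cartier: "\<phi> \<in> D e \<Longrightarrow> \<phi> \<in> carrier (cartier_group R p e)"
  using subalgebra subgroup.subset unfolding cartier_subalgebra_def by blast

lemmas D_closed = cartier_groupD(1)[OF D_cartier]
  and D_add = cartier_groupD(2)[OF D_cartier]
  and D_linear = cartier_groupD(3)[OF D_cartier]

lemma D_zero: "\<phi> \<in> D e \<Longrightarrow> \<phi> \<zero> = \<zero>"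
  using D_linear[of \<phi> e \<zero> \<zero>] D_closed[of \<phi> e \<zero>] by simp

lemma D_minus:
  assumes "\<phi> \<in> D e" "x \<in> carrier R"
  shows "\<phi> (\<ominus> x) = \<ominus> \<phi> x"
  using D_add[OF assms(1), of "\<ominus> x" x] D_closed[OF assms(1)] D_zero[OF assms(1)] assms(2)
  by (simp add: l_neg minus_equality)

lemma D_sum:
  assumes "\<phi> \<in> D e" "\<psi> \<in> D e"
  shows "(\<lambda>x \<in> carrier R. \<phi> x \<oplus> \<psi> x) \<in> D e"
proof -
  have "subgroup (D e) (cartier_group R p e)" using subalgebra unfolding cartier_subalgebra_def by blast
  from subgroup.m_closed[OF this assms] show ?thesis by (simp add: cartier_group_def)
qed

lemma D_compose:
  assumes "\<phi> \<in> D e" "\<psi> \<in> D d"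
  shows "(\<lambda>x \<in> carrier R. \<phi> (\<psi> x)) \<in> D (e + d)"
  using subalgebra assms unfolding cartier_subalgebra_def compose_def by blast

text \<open>Multiplications are the maps of degree zero, so each component of \<open>D\<close> is closed under composition
  with them on the right.\<close>

lemma D_premult:
  assumes "\<phi> \<in> D e" "a \<in> carrier R"
  shows "(\<lambda>x \<in> carrier R. \<phi> (a \<otimes> x)) \<in> D e"
proof -
  have "(\<lambda>x \<in> carrier R. a \<otimes> x) \<in> carrier (cartier_group R p 0)"
    using assms(2) by (intro cartier_groupI) (simp_all add: r_distr m_lcomm)
  then have "(\<lambda>x \<in> carrier R. a \<otimes> x) \<in> D 0" using subalgebra unfolding cartier_subalgebra_def by blast
  from D_compose[OF assms(1) this]
  show ?thesis by (simp cong: restrict_cong)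
qed

lemma q_Suc: "p ^ e = Suc (p ^ e - 1)"
  using p_pos by simp

lemma pow_q: "x \<in> carrier R \<Longrightarrow> x [^] (p ^ e) = x [^] (p ^ e - 1) \<otimes> x"
  by (subst q_Suc) (simp del: Suc_diff_1)

subsection \<open>Localized Cartier maps\<close>

context
  fixes P assumes P: "primeideal P R"
begin

interpretation P: primeideal P R by (rule P)
interpretation loc: mult_subset R "carrier R - P" by (rule P.mult_subset_complement)
interpretation L: cring "local_ring R P" unfolding local_ring_def by (rule loc.cring_localization)

text \<open>If \<open>u a s = u r b\<close>, then multiplying numerators by \<open>u s\<close> and \<open>u b\<close> and moving these factors
  through \<open>\<phi>\<close> as \<open>p\<^sup>e\<close>-th powers makes both sides agree. So the value does not depend on the
  representative.\<close>

lemma loc_map_fraction: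
  assumes \<phi>: "\<phi> \<in> D e" and r: "r \<in> carrier R" and s: "s \<in> carrier R - P"
  shows "loc_map R p P e \<phi> (loc.fraction r s) = loc.fraction (\<phi> (s [^] (p ^ e - 1) \<otimes> r)) s"
proof -
  let ?n = "p ^ e - 1"
  have "(\<Union>(a, b) \<in> loc.fraction r s. loc.fraction (\<phi> (b [^] ?n \<otimes> a)) b)
      = loc.fraction (\<phi> (s [^] ?n \<otimes> r)) s"
  proof (rule loc.UN_frac[OF r s])
    fix a b assume ab: "a \<in> carrier R" "b \<in> carrier R - P" "loc.fraction a b = loc.fraction r s"
    then obtain u where u: "u \<in> carrier R - P" "u \<otimes> (a \<otimes> s) = u \<otimes> (r \<otimes> b)"
      using loc.frac_eq_iff[OF ab(1,2) r s] by blast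
    have c: "s \<in> carrier R" "b \<in> carrier R" "u \<in> carrier R" using s ab u by auto
    \<comment> \<open>The common cofactor that turns both numerators into multiples of the two sides of the relation.\<close>
    let ?w = "u [^] ?n \<otimes> (b [^] ?n \<otimes> s [^] ?n)"
    have w: "?w \<in> carrier R" using c by simp
    have "u \<otimes> (\<phi> (b [^] ?n \<otimes> a) \<otimes> s) = (u \<otimes> s) \<otimes> \<phi> (b [^] ?n \<otimes> a)"
      using c ab(1) D_closed[OF \<phi>] by (simp add: m_ac)
    also have "\<dots> = \<phi> ((u \<otimes> s) [^] (p ^ e) \<otimes> (b [^] ?n \<otimes> a))"
      using c ab(1) D_linear[OF \<phi>] by simp
    also have "(u \<otimes> s) [^] (p ^ e) \<otimes> (b [^] ?n \<otimes> a) = ?w \<otimes> (u \<otimes> (a \<otimes> s))"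
      using c ab(1) by (simp add: pow_q nat_pow_distrib m_ac)
    also have "\<dots> = (u \<otimes> b) [^] (p ^ e) \<otimes> (s [^] ?n \<otimes> r)"
      unfolding u(2) using c r by (simp add: pow_q nat_pow_distrib m_ac)
    also have "\<phi> \<dots> = (u \<otimes> b) \<otimes> \<phi> (s [^] ?n \<otimes> r)"
      using c r D_linear[OF \<phi>] by simp
    also have "\<dots> = u \<otimes> (\<phi> (s [^] ?n \<otimes> r) \<otimes> b)"
      using c r D_closed[OF \<phi>] by (simp add: m_ac)
    finally show "loc.fraction (\<phi> (b [^] ?n \<otimes> a)) b = loc.fraction (\<phi> (s [^] ?n \<otimes> r)) s"
      using c ab r s u(1) D_closed[OF \<phi>] by (subst loc.frac_eq_iff) auto
  qed
  then show ?thesis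
    using loc.frac_in_L[OF r s] by (simp add: loc_map_def local_ring_def)
qed

lemma loc_map_cartier:
  assumes \<phi>: "\<phi> \<in> D e"
  shows "loc_map R p P e \<phi> \<in> carrier (cartier_group (local_ring R P) p e)"
proof -
  let ?n = "p ^ e - 1"
  let ?h = "loc_map R p P e \<phi>"
  note cl = D_closed[OF \<phi>]
  have fr: "\<exists>r \<in> carrier R. \<exists>s \<in> carrier R - P. A = loc.fraction r s" if "A \<in> carrier (local_ring R P)" for A
    using loc.L_cases[of A] that unfolding local_ring_def by blast
  have "(\<lambda>A \<in> carrier (local_ring R P). ?h A) \<in> carrier (cartier_group (local_ring R P) p e)"
  proof (rule L.cartier_groupI)
    fix A assume A: "A \<in> carrier (local_ring R P)"
    then obtain r s where rs: "r \<in> carrier R" "s \<in> carrier R - P" "A = loc.fraction r s" using fr by blast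
    then show "?h A \<in> carrier (local_ring R P)"
      using cl by (simp add: loc_map_fraction[OF \<phi>] local_ring_def)
    fix B assume "B \<in> carrier (local_ring R P)"
    then obtain r' s' where rs': "r' \<in> carrier R" "s' \<in> carrier R - P" "B = loc.fraction r' s'"
      using fr by blast
    have c: "s \<in> carrier R" "s' \<in> carrier R" "s \<otimes> s' \<in> carrier R - P" using rs rs' loc.S_mult by auto
    have "\<phi> ((s \<otimes> s') [^] ?n \<otimes> (r \<otimes> s' \<oplus> r' \<otimes> s))
        = \<phi> (s' [^] (p ^ e) \<otimes> (s [^] ?n \<otimes> r) \<oplus> s [^] (p ^ e) \<otimes> (s' [^] ?n \<otimes> r'))"
      using c rs(1) rs'(1) by (simp add: pow_q nat_pow_distrib r_distr m_ac)
    also have "\<dots> = \<phi> (s [^] ?n \<otimes> r) \<otimes> s' \<oplus> \<phi> (s' [^] ?n \<otimes> r') \<otimes> s"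
      using c rs(1) rs'(1) cl by (simp add: D_add[OF \<phi>] D_linear[OF \<phi>] m_comm)
    finally have num: "\<phi> ((s \<otimes> s') [^] ?n \<otimes> (r \<otimes> s' \<oplus> r' \<otimes> s))
        = \<phi> (s [^] ?n \<otimes> r) \<otimes> s' \<oplus> \<phi> (s' [^] ?n \<otimes> r') \<otimes> s" .
    have "?h (A \<oplus>\<^bsub>local_ring R P\<^esub> B) = ?h (loc.fraction (r \<otimes> s' \<oplus> r' \<otimes> s) (s \<otimes> s'))"
      using rs rs' by (simp add: local_ring_def loc.add_frac)
    also have "\<dots> = loc.fraction (\<phi> (s [^] ?n \<otimes> r) \<otimes> s' \<oplus> \<phi> (s' [^] ?n \<otimes> r') \<otimes> s) (s \<otimes> s')"
      unfolding num[symmetric] using c rs(1) rs'(1) by (intro loc_map_fraction[OF \<phi>]) auto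
    also have "\<dots> = ?h A \<oplus>\<^bsub>local_ring R P\<^esub> ?h B"
      using rs rs' c cl by (simp add: local_ring_def loc.add_frac loc_map_fraction[OF \<phi>])
    finally show "?h (A \<oplus>\<^bsub>local_ring R P\<^esub> B) = ?h A \<oplus>\<^bsub>local_ring R P\<^esub> ?h B" .
    have sq: "s [^] (p ^ e) \<in> carrier R - P" using rs(2) loc.S_pow by blast
    have c': "s [^] (p ^ e) \<otimes> s' \<in> carrier R - P" using loc.S_mult[OF sq rs'(2)] .
    have "(s [^] (p ^ e) \<otimes> s') [^] ?n \<otimes> (r [^] (p ^ e) \<otimes> r')
        = (r \<otimes> s [^] ?n) [^] (p ^ e) \<otimes> (s' [^] ?n \<otimes> r')"
      using c rs(1) rs'(1) by (simp add: nat_pow_distrib nat_pow_pow m_ac mult.commute)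
    then have num: "\<phi> ((s [^] (p ^ e) \<otimes> s') [^] ?n \<otimes> (r [^] (p ^ e) \<otimes> r'))
        = r \<otimes> s [^] ?n \<otimes> \<phi> (s' [^] ?n \<otimes> r')"
      using c rs(1) rs'(1) by (simp add: D_linear[OF \<phi>])
    have "?h (A [^]\<^bsub>local_ring R P\<^esub> (p ^ e) \<otimes>\<^bsub>local_ring R P\<^esub> B)
        = ?h (loc.fraction (r [^] (p ^ e) \<otimes> r') (s [^] (p ^ e) \<otimes> s'))"
      using rs rs' sq by (simp add: local_ring_def loc.pow_frac loc.mult_frac)
    also have "\<dots> = loc.fraction (r \<otimes> s [^] ?n \<otimes> \<phi> (s' [^] ?n \<otimes> r')) (s [^] (p ^ e) \<otimes> s')"
      unfolding num[symmetric] using c' rs(1) rs'(1) by (intro loc_map_fraction[OF \<phi>]) auto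
    also have "\<dots> = loc.fraction (r \<otimes> \<phi> (s' [^] ?n \<otimes> r')) (s \<otimes> s')"
      using c c' rs(1) rs'(1) cl by (intro loc.frac_eqI) (simp_all add: pow_q m_ac)
    also have "\<dots> = A \<otimes>\<^bsub>local_ring R P\<^esub> ?h B"
      using rs rs' c cl by (simp add: local_ring_def loc.mult_frac loc_map_fraction[OF \<phi>])
    finally show "?h (A [^]\<^bsub>local_ring R P\<^esub> (p ^ e) \<otimes>\<^bsub>local_ring R P\<^esub> B)
        = A \<otimes>\<^bsub>local_ring R P\<^esub> ?h B" .
  qed
  moreover have "(\<lambda>A \<in> carrier (local_ring R P). ?h A) = ?h"
    unfolding loc_map_def by (rule extensional_restrict[OF restrict_extensional])
  ultimately show ?thesis by simp
qed

text \<open>The maximal ideal \<open>P R\<^sub>P\<close> of the local ring.\<close>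

lemma ideal_of_local_ring:
  "ideal {loc.fraction r s | r s. r \<in> P \<and> s \<in> carrier R - P} (local_ring R P)" (is "ideal ?M _")
proof (rule L.ideal_of_closed)
  show "?M \<subseteq> carrier (local_ring R P)" using P.Icarr by (auto simp: local_ring_def)
  show "\<zero>\<^bsub>local_ring R P\<^esub> \<in> ?M"
    using loc.zero_L loc.S_one P.zero_closed unfolding local_ring_def by blast
  fix A assume "A \<in> ?M"
  then obtain r s where rs: "r \<in> P" "s \<in> carrier R - P" "A = loc.fraction r s" by blast
  {
    fix B assume "B \<in> ?M"
    then obtain r' s' where rs': "r' \<in> P" "s' \<in> carrier R - P" "B = loc.fraction r' s'" by blast
    have "A \<oplus>\<^bsub>local_ring R P\<^esub> B = loc.fraction (r \<otimes> s' \<oplus> r' \<otimes> s) (s \<otimes> s')"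
      using rs rs' P.Icarr by (simp add: local_ring_def loc.add_frac)
    moreover have "r \<otimes> s' \<oplus> r' \<otimes> s \<in> P" using rs rs' by (simp add: P.a_closed P.I_r_closed)
    moreover have "s \<otimes> s' \<in> carrier R - P" by (rule loc.S_mult[OF rs(2) rs'(2)])
    ultimately show "A \<oplus>\<^bsub>local_ring R P\<^esub> B \<in> ?M" by blast
  next
    fix B assume "B \<in> carrier (local_ring R P)"
    then obtain r' s' where rs': "r' \<in> carrier R" "s' \<in> carrier R - P" "B = loc.fraction r' s'"
      using loc.L_cases[of B] unfolding local_ring_def by blast
    have "B \<otimes>\<^bsub>local_ring R P\<^esub> A = loc.fraction (r' \<otimes> r) (s' \<otimes> s)"
      using rs rs' P.Icarr by (simp add: local_ring_def loc.mult_frac)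
    moreover have "r' \<otimes> r \<in> P" using rs rs' by (simp add: P.I_l_closed)
    moreover have "s' \<otimes> s \<in> carrier R - P" by (rule loc.S_mult[OF rs'(2) rs(2)])
    ultimately show "B \<otimes>\<^bsub>local_ring R P\<^esub> A \<in> ?M" by blast
  }
qed

lemma one_notin_ideal_of_local_ring:
  "\<one>\<^bsub>local_ring R P\<^esub> \<notin> {loc.fraction r s | r s. r \<in> P \<and> s \<in> carrier R - P}"
proof
  assume "\<one>\<^bsub>local_ring R P\<^esub> \<in> {loc.fraction r s | r s. r \<in> P \<and> s \<in> carrier R - P}"
  then obtain r s where rs: "r \<in> P" "s \<in> carrier R - P" "loc.fraction \<one> \<one> = loc.fraction r s"
    using loc.one_L unfolding local_ring_def by auto
  then obtain u where u: "u \<in> carrier R - P" "u \<otimes> (\<one> \<otimes> s) = u \<otimes> (r \<otimes> \<one>)"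
    using loc.frac_eq_iff[OF one_closed loc.S_one P.Icarr[OF rs(1)] rs(2)] by blast
  have "u \<otimes> s = u \<otimes> r" using u rs P.Icarr[OF rs(1)] by simp
  moreover have "u \<otimes> r \<in> P" using u rs by (simp add: P.I_l_closed)
  ultimately show False using loc.S_mult[OF u(1) rs(2)] by simp
qed

text \<open>F-purity at \<open>P\<close> can be tested on \<open>R\<close>. A sum of maps \<open>a \<cdot> \<phi>\<^sub>P\<close> can send 1 to a unit of the local ring only if
  some \<open>\<phi> 1\<close> is outside \<open>P\<close>: otherwise the maps sending 1 into \<open>P R\<^sub>P\<close> form a subgroup containing
  all the generators. Conversely \<open>\<phi> 1\<close> outside \<open>P\<close> becomes a unit, and dividing by it gives a splitting.\<close>

lemma F_pure_local_iff:
  "F_pure (local_ring R P) (cartier_localization R p D P) \<longleftrightarrow> (\<exists>e > 0. \<exists>\<phi> \<in> D e. \<phi> \<one> \<notin> P)"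
proof -
  let ?M = "{loc.fraction r s | r s. r \<in> P \<and> s \<in> carrier R - P}"
  let ?L = "local_ring R P"
  have oneL: "\<one>\<^bsub>?L\<^esub> = loc.fraction \<one> \<one>" using loc.one_L by (simp add: local_ring_def)
  have at_one: "loc_map R p P e \<phi> \<one>\<^bsub>?L\<^esub> = loc.fraction (\<phi> \<one>) \<one>" if "\<phi> \<in> D e" for \<phi> e
    unfolding oneL using loc_map_fraction[OF that one_closed loc.S_one] by simp
  have "\<exists>e > 0. \<exists>\<phi> \<in> D e. \<phi> \<one> \<notin> P" if pure: "F_pure ?L (cartier_localization R p D P)"
  proof -
    obtain e h where e: "e > 0" "h \<in> cartier_localization R p D P e" "h \<one>\<^bsub>?L\<^esub> = \<one>\<^bsub>?L\<^esub>"
      using pure unfolding F_pure_def by blast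
    show "\<exists>e > 0. \<exists>\<phi> \<in> D e. \<phi> \<one> \<notin> P"
    proof (rule ccontr)
      assume "\<not> ?thesis"
      then have inP: "\<phi> \<one> \<in> P" if "\<phi> \<in> D e" for \<phi> using that e(1) by blast
      interpret G: group "cartier_group ?L p e" by (rule L.cartier_group_is_group)
      interpret M: ideal ?M ?L by (rule ideal_of_local_ring)
      let ?N = "{h \<in> carrier (cartier_group ?L p e). h \<one>\<^bsub>?L\<^esub> \<in> ?M}"
      have mult: "(h \<otimes>\<^bsub>cartier_group ?L p e\<^esub> k) \<one>\<^bsub>?L\<^esub> = h \<one>\<^bsub>?L\<^esub> \<oplus>\<^bsub>?L\<^esub> k \<one>\<^bsub>?L\<^esub>" for h k
        by (simp add: cartier_group_def)
      have one: "\<one>\<^bsub>cartier_group ?L p e\<^esub> \<one>\<^bsub>?L\<^esub> = \<zero>\<^bsub>?L\<^esub>" by (simp add: cartier_group_def)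
      have "subgroup ?N (cartier_group ?L p e)"
      proof (rule subgroup.intro)
        show "h \<otimes>\<^bsub>cartier_group ?L p e\<^esub> k \<in> ?N" if "h \<in> ?N" "k \<in> ?N" for h k
          using that mult M.a_closed[of "h \<one>\<^bsub>?L\<^esub>" "k \<one>\<^bsub>?L\<^esub>"] by simp
        show "\<one>\<^bsub>cartier_group ?L p e\<^esub> \<in> ?N" using one M.zero_closed by simp
        show "inv\<^bsub>cartier_group ?L p e\<^esub> h \<in> ?N" if h: "h \<in> ?N" for h
        proof -
          let ?k = "inv\<^bsub>cartier_group ?L p e\<^esub> h"
          have k: "?k \<in> carrier (cartier_group ?L p e)" using h by simp
          have "?k \<one>\<^bsub>?L\<^esub> \<oplus>\<^bsub>?L\<^esub> h \<one>\<^bsub>?L\<^esub> = \<zero>\<^bsub>?L\<^esub>"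
            using mult[of ?k h] one h by simp
          then have "?k \<one>\<^bsub>?L\<^esub> \<oplus>\<^bsub>?L\<^esub> h \<one>\<^bsub>?L\<^esub> \<in> ?M" using M.zero_closed by simp
          then have "?k \<one>\<^bsub>?L\<^esub> \<in> ?M"
            using L.ideal_add_cancel[OF M.is_ideal _ _ , of "?k \<one>\<^bsub>?L\<^esub>" "h \<one>\<^bsub>?L\<^esub>"]
              L.cartier_groupD(1)[OF k L.one_closed] h by simp
          with k show ?thesis by simp
        qed
      qed blast
      moreover have "{(\<lambda>A \<in> carrier ?L. a \<otimes>\<^bsub>?L\<^esub> loc_map R p P e \<phi> A) | a \<phi>.
          a \<in> carrier ?L \<and> \<phi> \<in> D e} \<subseteq> ?N"
      proof (rule subsetI)
        fix h assume "h \<in> {(\<lambda>A \<in> carrier ?L. a \<otimes>\<^bsub>?L\<^esub> loc_map R p P e \<phi> A) | a \<phi>.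
          a \<in> carrier ?L \<and> \<phi> \<in> D e}"
        then obtain a \<phi> where a: "a \<in> carrier ?L" and \<phi>: "\<phi> \<in> D e"
          and h: "h = (\<lambda>A \<in> carrier ?L. a \<otimes>\<^bsub>?L\<^esub> loc_map R p P e \<phi> A)" by blast
        have "loc.fraction (\<phi> \<one>) \<one> \<in> ?M" using inP[OF \<phi>] loc.S_one by blast
        from M.I_l_closed[OF this a]
        have "h \<one>\<^bsub>?L\<^esub> \<in> ?M"
          using h at_one[OF \<phi>] L.one_closed by simp
        with L.cartier_group_scale[OF loc_map_cartier[OF \<phi>] a]
        show "h \<in> ?N" unfolding h[symmetric] by simp
      qed
      ultimately have "cartier_localization R p D P e \<subseteq> ?N"
        unfolding cartier_localization_def by (intro G.generate_subgroup_incl)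
      then have "h \<one>\<^bsub>?L\<^esub> \<in> ?M" using e(2) by blast
      then show False using e(3) one_notin_ideal_of_local_ring by simp
    qed
  qed
  moreover have "F_pure ?L (cartier_localization R p D P)"
    if e: "e > 0" "\<phi> \<in> D e" "\<phi> \<one> \<notin> P" for e \<phi>
  proof -
    have u: "\<phi> \<one> \<in> carrier R - P" using e D_closed[OF e(2)] by simp
    let ?a = "loc.fraction \<one> (\<phi> \<one>)"
    have a: "?a \<in> carrier ?L" using u by (simp add: local_ring_def)
    let ?h = "\<lambda>A \<in> carrier ?L. ?a \<otimes>\<^bsub>?L\<^esub> loc_map R p P e \<phi> A"
    have "?h \<in> cartier_localization R p D P e"
      unfolding cartier_localization_def using a e(2) by (intro generate.incl) blast
    moreover have "?h \<one>\<^bsub>?L\<^esub> = ?a \<otimes>\<^bsub>?L\<^esub> loc.fraction (\<phi> \<one>) \<one>"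
      using at_one[OF e(2)] L.one_closed by simp
    moreover have "\<dots> = loc.fraction (\<one> \<otimes> \<phi> \<one>) (\<phi> \<one> \<otimes> \<one>)"
      using u loc.S_one by (simp add: local_ring_def loc.mult_frac)
    moreover have "\<dots> = \<one>\<^bsub>?L\<^esub>"
      unfolding oneL using u loc.S_one by (intro loc.frac_eqI) auto
    ultimately show ?thesis
      unfolding F_pure_def using e(1) by metis
  qed
  ultimately show ?thesis by blast
qed

end

lemma F_pure_locus_iff:
  "P \<in> F_pure_locus R p D \<longleftrightarrow> primeideal P R \<and> (\<exists>e > 0. \<exists>\<phi> \<in> D e. \<phi> \<one> \<notin> P)"
  unfolding F_pure_locus_def Spec_def using F_pure_local_iff by blast

section \<open>The Cartier core\<close>

lemma core_iff:
  "r \<in> cartier_core R D J \<longleftrightarrow> r \<in> carrier R \<and> (\<forall>e > 0. \<forall>\<phi> \<in> D e. \<phi> r \<in> J)"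
  by (simp add: cartier_core_def)

lemma core_map: "r \<in> cartier_core R D J \<Longrightarrow> e > 0 \<Longrightarrow> \<phi> \<in> D e \<Longrightarrow> \<phi> r \<in> J"
  by (simp add: core_iff)

lemma core_ideal:
  assumes "ideal J R"
  shows "ideal (cartier_core R D J) R"
proof -
  interpret J: ideal J R by fact
  show ?thesis
  proof (rule ideal_of_closed)
    show "x \<otimes> a \<in> cartier_core R D J" if "a \<in> cartier_core R D J" "x \<in> carrier R" for a x
      unfolding core_iff
    proof (intro conjI allI impI ballI)
      fix e \<phi> assume "0 < (e::nat)" "\<phi> \<in> D e"
      then have "(\<lambda>y \<in> carrier R. \<phi> (x \<otimes> y)) a \<in> J"
        using that D_premult[of \<phi> e x] unfolding core_iff by blast
      then show "\<phi> (x \<otimes> a) \<in> J" using that by (simp add: core_iff)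
    qed (use that in \<open>simp add: core_iff\<close>)
  qed (auto simp: core_iff D_zero D_add J.a_closed)
qed

lemma core_compatible:
  assumes "ideal J R"
  shows "D_compatible R D (cartier_core R D J)"
  unfolding D_compatible_def
proof (intro conjI allI ballI)
  show "ideal (cartier_core R D J) R" by (rule core_ideal[OF assms])
  fix d \<psi> assume \<psi>: "\<psi> \<in> D d"
  show "\<psi> ` cartier_core R D J \<subseteq> cartier_core R D J"
  proof (rule image_subsetI)
    fix r assume r: "r \<in> cartier_core R D J"
    have "\<phi> (\<psi> r) \<in> J" if "e > 0" "\<phi> \<in> D e" for e \<phi>
    proof -
      have "(\<lambda>x \<in> carrier R. \<phi> (\<psi> x)) r \<in> J"
        using that(1) by (intro core_map[OF r _ D_compose[OF that(2) \<psi>]]) simp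
      then show ?thesis using r by (simp add: core_iff)
    qed
    then show "\<psi> r \<in> cartier_core R D J" using r D_closed[OF \<psi>] by (simp add: core_iff)
  qed
qed

lemma compatible_subset_core:
  assumes "D_compatible R D J"
  shows "J \<subseteq> cartier_core R D J"
proof
  fix r assume "r \<in> J"
  moreover have "ideal J R" and "\<And>e \<phi>. \<phi> \<in> D e \<Longrightarrow> \<phi> ` J \<subseteq> J"
    using assms unfolding D_compatible_def by simp_all
  ultimately show "r \<in> cartier_core R D J"
    unfolding core_iff using ideal.Icarr[of J R r] by (simp add: image_subset_iff)
qed

text \<open>For \<open>r\<close> in the core, \<open>r \<phi>(1) = \<phi>(r\<^sup>q)\<close> with \<open>q = p\<^sup>e\<close> lies in \<open>P\<close>, and \<open>\<phi>(1)\<close> does not.\<close>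

lemma core_subset:
  assumes "P \<in> F_pure_locus R p D"
  shows "cartier_core R D P \<subseteq> P"
proof
  fix r assume r: "r \<in> cartier_core R D P"
  from assms obtain e \<phi> where P: "primeideal P R" and e: "e > 0" "\<phi> \<in> D e" "\<phi> \<one> \<notin> P"
    unfolding F_pure_locus_iff by blast
  interpret P: primeideal P R by fact
  interpret C: ideal "cartier_core R D P" R by (rule core_ideal[OF P.is_ideal])
  have rc: "r \<in> carrier R" using r C.Icarr by blast
  have "r [^] (p ^ e) \<otimes> \<one> \<in> cartier_core R D P"
    using rc r by (simp add: pow_q C.I_l_closed)
  then have "\<phi> (r [^] (p ^ e) \<otimes> \<one>) \<in> P" using e unfolding core_iff by blast
  then have "r \<otimes> \<phi> \<one> \<in> P" using D_linear[OF e(2) rc one_closed] by simp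
  then show "r \<in> P" using P.I_prime[OF rc D_closed[OF e(2) one_closed]] e(3) by blast
qed

lemma core_fixes_compatible:
  assumes "P \<in> F_pure_locus R p D" "D_compatible R D P"
  shows "cartier_core R D P = P"
  using core_subset[OF assms(1)] compatible_subset_core[OF assms(2)] by blast

text \<open>Suppose \<open>\<phi> a\<close> and \<open>v = \<psi> b\<close> are outside \<open>P\<close>, with \<open>\<phi>\<close> of degree \<open>e\<close> and \<open>\<psi>\<close> of degree \<open>f\<close>. Then some
  multiple of \<open>a b\<close> is sent outside \<open>P\<close> by \<open>\<phi> \<circ> \<psi>\<close>. The multiplier is chosen so that \<open>\<psi>\<close> first releases
  \<open>a\<close> and \<open>v\<^sup>q\<^sup>-\<^sup>1\<close>, where \<open>q = p\<^sup>e\<close>, next to \<open>\<psi> b = v\<close>, and \<open>\<phi>\<close> then releases \<open>v\<close>, which leaves \<open>v \<phi>(a)\<close>.\<close>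

lemma core_prime:
  assumes "P \<in> F_pure_locus R p D"
  shows "primeideal (cartier_core R D P) R"
proof -
  have P: "primeideal P R" using assms F_pure_locus_iff by blast
  interpret P: primeideal P R by fact
  show ?thesis
  proof (rule primeidealI[OF core_ideal[OF P.is_ideal] is_cring])
    show "carrier R \<noteq> cartier_core R D P"
    proof
      assume "carrier R = cartier_core R D P"
      then have "\<one> \<in> P" using core_subset[OF assms] one_closed by blast
      then show False using P.one_imp_carrier P.I_notcarr by simp
    qed
    fix a b assume ab: "a \<in> carrier R" "b \<in> carrier R" "a \<otimes> b \<in> cartier_core R D P"
    show "a \<in> cartier_core R D P \<or> b \<in> cartier_core R D P"
    proof (rule ccontr)
      assume "\<not> ?thesis"
      then obtain e \<phi> f \<psi> where e: "e > 0" "\<phi> \<in> D e" "\<phi> a \<notin> P" and f: "f > 0" "\<psi> \<in> D f" "\<psi> b \<notin> P"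
        using ab(1,2) unfolding core_iff by blast
      define v where "v = \<psi> b"
      have v: "v \<in> carrier R" "v \<notin> P" using f D_closed ab by (auto simp: v_def)
      \<comment> \<open>The power of \<open>v\<close> leaves one factor \<open>v\<close> to be supplied by \<open>\<psi> b\<close>.\<close>
      let ?w = "a \<otimes> v [^] (p ^ e - 1)"
      have w: "?w \<in> carrier R" using ab v by simp
      have "?w [^] (p ^ f) \<otimes> b
          = (a [^] (p ^ f - 1) \<otimes> (v [^] (p ^ e - 1)) [^] (p ^ f)) \<otimes> (a \<otimes> b)"
        using ab v(1) by (simp add: nat_pow_distrib pow_q[of a] m_ac)
      also have "\<dots> \<in> cartier_core R D P"
        using ab v(1) by (simp add: ideal.I_l_closed[OF core_ideal[OF P.is_ideal]])
      finally have "(\<lambda>x \<in> carrier R. \<phi> (\<psi> x)) (?w [^] (p ^ f) \<otimes> b) \<in> P"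
        using e(1) by (intro core_map[OF _ _ D_compose[OF e(2) f(2)]]) simp_all
      then have "\<phi> (?w \<otimes> v) \<in> P"
        using D_linear[OF f(2) w ab(2)] w ab by (simp add: v_def)
      moreover have "?w \<otimes> v = v [^] (p ^ e) \<otimes> a"
        using ab v(1) by (simp add: pow_q m_ac)
      ultimately have "v \<otimes> \<phi> a \<in> P" using D_linear[OF e(2) v(1) ab(1)] by simp
      then show False using P.I_prime[OF v(1) D_closed[OF e(2) ab(1)]] v(2) e(3) by simp
    qed
  qed
qed

lemma core_in_F_pure_locus:
  assumes "P \<in> F_pure_locus R p D"
  shows "cartier_core R D P \<in> F_pure_locus R p D"
proof -
  obtain e \<phi> where "e > 0" "\<phi> \<in> D e" "\<phi> \<one> \<notin> P" using assms unfolding F_pure_locus_iff by blast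
  moreover from this have "\<phi> \<one> \<notin> cartier_core R D P" using core_subset[OF assms] by blast
  ultimately show ?thesis unfolding F_pure_locus_iff using core_prime[OF assms] by blast
qed

text \<open>A core of a point of the locus is again a point of the locus, since a map with \<open>\<phi>(1)\<close> outside \<open>P\<close>
  has \<open>\<phi>(1)\<close> outside the smaller prime too; and compatible points are their own cores.\<close>

lemma core_image:
  "cartier_core R D ` F_pure_locus R p D = {Q \<in> F_pure_locus R p D. D_compatible R D Q}"
proof (intro equalityI subsetI)
  fix Q assume "Q \<in> cartier_core R D ` F_pure_locus R p D"
  then obtain P where P: "P \<in> F_pure_locus R p D" "Q = cartier_core R D P" by blast
  have "ideal P R" using P(1) primeideal.axioms(1) unfolding F_pure_locus_iff by blast
  then show "Q \<in> {Q \<in> F_pure_locus R p D. D_compatible R D Q}"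
    using core_in_F_pure_locus[OF P(1)] core_compatible P(2) by blast
next
  fix Q assume "Q \<in> {Q \<in> F_pure_locus R p D. D_compatible R D Q}"
  then show "Q \<in> cartier_core R D ` F_pure_locus R p D"
    using core_fixes_compatible[of Q] by (metis (mono_tags, lifting) image_eqI mem_Collect_eq)
qed

text \<open>The core of \<open>P\<close> contains a set \<open>E\<close> exactly when \<open>P\<close> contains all the images \<open>\<phi> r\<close> of elements \<open>r\<close> of \<open>E\<close>
  under maps of positive degree, so the preimage of a closed set is closed.\<close>

lemma core_continuous:
  "continuous_map (subtopology (zariski R) (F_pure_locus R p D)) (zariski R) (cartier_core R D)"
proof -
  have top: "topspace (zariski R) = Spec R"
  proof
    show "topspace (zariski R) \<subseteq> Spec R"
    proof -
      obtain E where "topspace (zariski R) = Spec R - zero_locus R E"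
        using openin_topspace[of "zariski R"] unfolding openin_zariski by blast
      then show ?thesis by blast
    qed
    have "zero_locus R (carrier R) = {}"
    proof -
      have "\<not> carrier R \<subseteq> P" if "primeideal P R" for P
        using primeideal.I_notcarr[OF that] ideal.Icarr[OF primeideal.axioms(1)[OF that]] by blast
      then show ?thesis by (auto simp: zero_locus_def Spec_def)
    qed
    then have "openin (zariski R) (Spec R)"
      unfolding openin_zariski by (intro exI[of _ "carrier R"]) simp
    then show "Spec R \<subseteq> topspace (zariski R)" by (rule openin_subset)
  qed
  let ?U = "F_pure_locus R p D"
  have U: "?U \<subseteq> Spec R" unfolding F_pure_locus_def by blast
  show ?thesis
    unfolding continuous_map_def topspace_subtopology top
  proof (intro conjI allI impI)
    show "cartier_core R D \<in> Spec R \<inter> ?U \<rightarrow> Spec R"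
      using core_prime by (auto simp: Spec_def)
    fix V assume "openin (zariski R) V"
    then obtain E where E: "E \<subseteq> carrier R" "V = Spec R - zero_locus R E" unfolding openin_zariski by blast
    let ?E = "{\<phi> r | \<phi> r e. r \<in> E \<and> e > 0 \<and> \<phi> \<in> D e}"
    have "E \<subseteq> cartier_core R D P \<longleftrightarrow> ?E \<subseteq> P" for P
    proof
      assume "E \<subseteq> cartier_core R D P"
      then show "?E \<subseteq> P" using core_map by blast
    next
      assume "?E \<subseteq> P"
      then show "E \<subseteq> cartier_core R D P" using E(1) unfolding subset_iff core_iff by blast
    qed
    then have mem: "cartier_core R D P \<in> V \<longleftrightarrow> P \<in> Spec R - zero_locus R ?E" if "P \<in> ?U" for P
      using core_prime[OF that] subsetD[OF U that] that unfolding E(2) zero_locus_def Spec_def by simp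
    have "{P \<in> Spec R \<inter> ?U. cartier_core R D P \<in> V} = (Spec R - zero_locus R ?E) \<inter> ?U"
      using mem by blast
    moreover have "?E \<subseteq> carrier R" using E(1) D_closed by blast
    ultimately show "openin (subtopology (zariski R) ?U) {P \<in> Spec R \<inter> ?U. cartier_core R D P \<in> V}"
      unfolding openin_subtopology openin_zariski by (intro exI[of _ "Spec R - zero_locus R ?E"]) blast
  qed
qed

end

section \<open>Finitely many compatible primes\<close>

text \<open>\<open>G\<close> generates \<open>R\<close> as a module over its subring of \<open>q\<close>-th powers. The closure formulation makes
  every additive \<open>q\<close>-linear identity on \<open>G\<close> extend to \<open>R\<close> without choosing coefficients.\<close>

definition power_generates :: "('a, 'm) ring_scheme \<Rightarrow> nat \<Rightarrow> 'a set \<Rightarrow> bool" where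
  "power_generates R q G \<longleftrightarrow> (\<forall>H. H \<subseteq> carrier R \<and> \<zero>\<^bsub>R\<^esub> \<in> H \<and>
     (\<forall>x \<in> H. \<forall>y \<in> H. x \<oplus>\<^bsub>R\<^esub> y \<in> H) \<and> (\<forall>a \<in> carrier R. \<forall>x \<in> H. a [^]\<^bsub>R\<^esub> q \<otimes>\<^bsub>R\<^esub> x \<in> H) \<and>
     G \<subseteq> H \<longrightarrow> H = carrier R)"

lemma power_generatesD:
  fixes R (structure)
  assumes "power_generates R q G" "H \<subseteq> carrier R" "\<zero> \<in> H"
    and "\<And>x y. x \<in> H \<Longrightarrow> y \<in> H \<Longrightarrow> x \<oplus> y \<in> H"
    and "\<And>a x. a \<in> carrier R \<Longrightarrow> x \<in> H \<Longrightarrow> a [^] q \<otimes> x \<in> H"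
    and "G \<subseteq> H"
  shows "H = carrier R"
  using assms unfolding power_generates_def by simp

lemma (in cring) F_finite_power_generates_1:
  assumes "F_finite R p"
  shows "\<exists>G. finite G \<and> G \<subseteq> carrier R \<and> power_generates R p G"
proof -
  define M where "M = Frob R p 1"
  obtain A where A: "finite A" "A \<subseteq> carrier R"
    "\<And>x. x \<in> carrier R \<Longrightarrow> \<exists>c \<in> A \<rightarrow> carrier R. x = (\<Oplus>\<^bsub>M\<^esub>a\<in>A. c a \<odot>\<^bsub>M\<^esub> a)"
    using assms unfolding F_finite_def fg_module_def by (auto simp: Frob_def M_def)
  interpret M: abelian_monoid M
    by (rule abelian_monoidI) (auto simp: Frob_def M_def a_ac)
  have M: "carrier M = carrier R" "\<zero>\<^bsub>M\<^esub> = \<zero>" "x \<oplus>\<^bsub>M\<^esub> y = x \<oplus> y" "r \<odot>\<^bsub>M\<^esub> x = r [^] p \<otimes> x" for x y r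
    by (simp_all add: Frob_def M_def)
  have "power_generates R p A"
    unfolding power_generates_def
  proof (intro allI impI)
    fix H assume H: "H \<subseteq> carrier R \<and> \<zero> \<in> H \<and> (\<forall>x \<in> H. \<forall>y \<in> H. x \<oplus> y \<in> H) \<and>
      (\<forall>a \<in> carrier R. \<forall>x \<in> H. a [^] p \<otimes> x \<in> H) \<and> A \<subseteq> H"
    have sum: "(\<Oplus>\<^bsub>M\<^esub>a\<in>B. c a \<odot>\<^bsub>M\<^esub> a) \<in> H"
      if "finite B" "B \<subseteq> A" "c \<in> A \<rightarrow> carrier R" for B c
      using that(1,2)
    proof (induction B rule: finite_induct)
      case empty
      then show ?case using H by (simp add: M)
    next
      case (insert b B)
      have c: "c a \<odot>\<^bsub>M\<^esub> a \<in> carrier M" if "a \<in> A" for a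
      proof -
        have "c a \<in> carrier R" "a \<in> carrier R" using that \<open>c \<in> A \<rightarrow> carrier R\<close> A(2) by auto
        then show ?thesis by (simp add: M)
      qed
      have "(\<Oplus>\<^bsub>M\<^esub>a\<in>insert b B. c a \<odot>\<^bsub>M\<^esub> a) = c b \<odot>\<^bsub>M\<^esub> b \<oplus>\<^bsub>M\<^esub> (\<Oplus>\<^bsub>M\<^esub>a\<in>B. c a \<odot>\<^bsub>M\<^esub> a)"
        using insert c by (intro M.finsum_insert) auto
      moreover have "c b \<in> carrier R" "b \<in> H" using insert.prems that(3) H by auto
      ultimately show ?case using insert H by (simp add: M)
    qed
    have "x \<in> H" if "x \<in> carrier R" for x
    proof -
      obtain c where "c \<in> A \<rightarrow> carrier R" "x = (\<Oplus>\<^bsub>M\<^esub>a\<in>A. c a \<odot>\<^bsub>M\<^esub> a)" using A(3)[OF \<open>x \<in> carrier R\<close>] by blast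
      then show ?thesis using sum[OF A(1) subset_refl] by simp
    qed
    then show "H = carrier R" using H by blast
  qed
  then show ?thesis using A by blast
qed

text \<open>If the \<open>h\<close> generate over \<open>p\<^sup>e\<close>-th powers and the \<open>g\<close> generate over \<open>p\<close>-th powers, then the products
  \<open>h\<^sup>p g\<close> generate over \<open>p\<close>-th powers of \<open>p\<^sup>e\<close>-th powers, as Frobenius is additive.\<close>

lemma (in cring) F_finite_power_generates:
  assumes "Factorial_Ring.prime (p::nat)" "has_char R p" "F_finite R p"
  shows "\<exists>G. finite G \<and> G \<subseteq> carrier R \<and> power_generates R (p ^ e) G"
proof (induction e)
  case 0
  have "power_generates R (p ^ 0) {\<one>}"
    unfolding power_generates_def
  proof (intro allI impI, elim conjE)
    fix H assume H: "H \<subseteq> carrier R" "\<forall>a \<in> carrier R. \<forall>x \<in> H. a [^] (p ^ 0) \<otimes> x \<in> H" "{\<one>} \<subseteq> H"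
    have "x \<in> H" if "x \<in> carrier R" for x
      using bspec[OF bspec[OF H(2) that], of \<one>] H(3) that by simp
    then show "H = carrier R" using H(1) by blast
  qed
  then show ?case by (intro exI[of _ "{\<one>}"]) simp
next
  case (Suc e)
  then obtain G where G: "finite G" "G \<subseteq> carrier R" "power_generates R (p ^ e) G" by blast
  obtain A where A: "finite A" "A \<subseteq> carrier R" "power_generates R p A"
    using F_finite_power_generates_1[OF assms(3)] by blast
  let ?B = "(\<lambda>(h, g). h [^] p \<otimes> g) ` (G \<times> A)"
  have pow: "a [^] (p ^ Suc e) = (a [^] (p ^ e)) [^] p" if "a \<in> carrier R" for a
    using that by (simp add: nat_pow_pow mult.commute)
  have p0: "p > 0" using assms(1) prime_gt_0_nat by blast
  have "power_generates R (p ^ Suc e) ?B"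
    unfolding power_generates_def
  proof (intro allI impI, elim conjE)
    fix H assume H: "H \<subseteq> carrier R" "\<zero> \<in> H" "\<forall>x \<in> H. \<forall>y \<in> H. x \<oplus> y \<in> H"
      "\<forall>a \<in> carrier R. \<forall>x \<in> H. a [^] (p ^ Suc e) \<otimes> x \<in> H" "?B \<subseteq> H"
    have inner: "{a \<in> carrier R. a [^] p \<otimes> g \<in> H} = carrier R" if g: "g \<in> A" for g
    proof (rule power_generatesD[OF G(3)])
      have gc: "g \<in> carrier R" using g A(2) by blast
      show "\<zero> \<in> {a \<in> carrier R. a [^] p \<otimes> g \<in> H}" using gc H(2) p0 by (simp add: nat_pow_zero)
      show "x \<oplus> y \<in> {a \<in> carrier R. a [^] p \<otimes> g \<in> H}"
        if "x \<in> {a \<in> carrier R. a [^] p \<otimes> g \<in> H}" "y \<in> {a \<in> carrier R. a [^] p \<otimes> g \<in> H}" for x y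
        using that H(3) gc by (simp add: frobenius_add[OF assms(1,2)] l_distr)
      show "a [^] (p ^ e) \<otimes> x \<in> {a \<in> carrier R. a [^] p \<otimes> g \<in> H}"
        if "a \<in> carrier R" "x \<in> {a \<in> carrier R. a [^] p \<otimes> g \<in> H}" for a x
      proof -
        have "a [^] (p ^ Suc e) \<otimes> (x [^] p \<otimes> g) \<in> H" using that H(4) by blast
        moreover have "(a [^] (p ^ e) \<otimes> x) [^] p \<otimes> g = a [^] (p ^ Suc e) \<otimes> (x [^] p \<otimes> g)"
          using that gc pow by (simp add: nat_pow_distrib m_assoc del: power_Suc)
        ultimately show ?thesis using that by simp
      qed
      show "G \<subseteq> {a \<in> carrier R. a [^] p \<otimes> g \<in> H}" using H(5) g G(2) by auto
    qed blast
    let ?K = "{x \<in> carrier R. \<forall>a \<in> carrier R. a [^] p \<otimes> x \<in> H}"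
    have "?K = carrier R"
    proof (rule power_generatesD[OF A(3)])
      show "\<zero> \<in> ?K" using H(2) by simp
      show "x \<oplus> y \<in> ?K" if "x \<in> ?K" "y \<in> ?K" for x y
        using that H(3) by (simp add: r_distr)
      show "b [^] p \<otimes> x \<in> ?K" if "b \<in> carrier R" "x \<in> ?K" for b x
      proof -
        have "a [^] p \<otimes> (b [^] p \<otimes> x) = (a \<otimes> b) [^] p \<otimes> x" if "a \<in> carrier R" for a
          using that \<open>b \<in> carrier R\<close> \<open>x \<in> ?K\<close> by (simp add: nat_pow_distrib m_assoc)
        then show ?thesis using that by simp
      qed
      show "A \<subseteq> ?K" using inner A(2) by blast
    qed blast
    then have "\<one> [^] p \<otimes> x \<in> H" if "x \<in> carrier R" for x using that one_closed by blast
    then show "H = carrier R" using H(1) by auto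
  qed
  moreover have "finite ?B" "?B \<subseteq> carrier R" using G A by auto
  ultimately show ?case by blast
qed

context cartier_algebra
begin

text \<open>With \<open>q = p\<^sup>e\<close> these are the operators \<open>h \<mapsto> \<Sum>\<^sub>i \<phi>(y\<^sub>i h)\<^sup>q x\<^sub>i\<close>. Over the fraction field of a domain
  on which \<open>\<phi>\<close> is nonzero, the pairing \<open>(x, y) \<mapsto> \<phi>(x y)\<close> is nondegenerate; the identity is then such
  an operator, with dual bases \<open>x\<^sub>i\<close> and \<open>y\<^sub>i\<close>. The factor \<open>a\<^sup>q\<close> in the inductive step absorbs the
  denominators that appear when one stays inside \<open>R\<close>.\<close>

inductive trace_operator :: "nat \<Rightarrow> ('a \<Rightarrow> 'a) \<Rightarrow> ('a \<Rightarrow> 'a) \<Rightarrow> bool" for e \<phi> where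
  zero: "trace_operator e \<phi> (\<lambda>h. \<zero>)"
| step: "trace_operator e \<phi> T \<Longrightarrow> a \<in> carrier R \<Longrightarrow> x \<in> carrier R \<Longrightarrow> y \<in> carrier R \<Longrightarrow>
    trace_operator e \<phi> (\<lambda>h. a [^] (p ^ e) \<otimes> T h \<oplus> \<phi> (y \<otimes> h) [^] (p ^ e) \<otimes> x)"

context
  fixes e \<phi>
  assumes prime_p: "Factorial_Ring.prime p" and char_p: "has_char R p"
    and e_pos: "e > 0" and \<phi>: "\<phi> \<in> D e"
begin

abbreviation "q \<equiv> p ^ e"

lemmas \<phi>_closed = D_closed[OF \<phi>] and \<phi>_add = D_add[OF \<phi>] and \<phi>_linear = D_linear[OF \<phi>]

lemma \<phi>_minus: "x \<in> carrier R \<Longrightarrow> y \<in> carrier R \<Longrightarrow> \<phi> (x \<ominus> y) = \<phi> x \<ominus> \<phi> y"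
  by (simp add: minus_eq \<phi>_add D_minus[OF \<phi>])

lemma trace_operator_closed: "trace_operator e \<phi> T \<Longrightarrow> h \<in> carrier R \<Longrightarrow> T h \<in> carrier R"
  by (induction rule: trace_operator.induct) (simp_all add: \<phi>_closed)

lemma trace_operator_add:
  "trace_operator e \<phi> T \<Longrightarrow> g \<in> carrier R \<Longrightarrow> h \<in> carrier R \<Longrightarrow> T (g \<oplus> h) = T g \<oplus> T h"
proof (induction rule: trace_operator.induct)
  case (step T a x y)
  have c: "T g \<in> carrier R" "T h \<in> carrier R" "\<phi> (y \<otimes> g) \<in> carrier R" "\<phi> (y \<otimes> h) \<in> carrier R"
    using step trace_operator_closed \<phi>_closed by simp_all
  have "\<phi> (y \<otimes> (g \<oplus> h)) [^] q = \<phi> (y \<otimes> g) [^] q \<oplus> \<phi> (y \<otimes> h) [^] q"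
    using step c by (simp add: r_distr \<phi>_add frobenius_power_add[OF prime_p char_p])
  then show ?case using step c by (simp add: r_distr l_distr a_ac)
qed simp

lemma trace_operator_linear:
  "trace_operator e \<phi> T \<Longrightarrow> b \<in> carrier R \<Longrightarrow> h \<in> carrier R \<Longrightarrow> T (b [^] q \<otimes> h) = b [^] q \<otimes> T h"
proof (induction rule: trace_operator.induct)
  case (step T a x y)
  have c: "T h \<in> carrier R" "\<phi> (y \<otimes> h) \<in> carrier R"
    using step trace_operator_closed \<phi>_closed by simp_all
  have "y \<otimes> (b [^] q \<otimes> h) = b [^] q \<otimes> (y \<otimes> h)" using step by (simp add: m_lcomm)
  then have "\<phi> (y \<otimes> (b [^] q \<otimes> h)) [^] q = b [^] q \<otimes> \<phi> (y \<otimes> h) [^] q"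
    using step c by (simp add: \<phi>_linear nat_pow_distrib)
  then show ?case using step c by (simp add: r_distr m_ac)
qed simp

text \<open>\<open>T\<close> has an adjoint for the pairing \<open>(s, h) \<mapsto> \<phi>(s h)\<close>: every functional \<open>h \<mapsto> \<phi>(s T h)\<close> is again
  multiplication by an element followed by \<open>\<phi>\<close>.\<close>

lemma trace_operator_adjoint:
  "trace_operator e \<phi> T \<Longrightarrow> s \<in> carrier R \<Longrightarrow> \<exists>z \<in> carrier R. \<forall>h \<in> carrier R. \<phi> (s \<otimes> T h) = \<phi> (z \<otimes> h)"
proof (induction rule: trace_operator.induct)
  case zero
  then show ?case by (intro bexI[of _ \<zero>]) simp_all
next
  case (step T a x y)
  then obtain z where z: "z \<in> carrier R" "\<And>h. h \<in> carrier R \<Longrightarrow> \<phi> (s \<otimes> T h) = \<phi> (z \<otimes> h)" by blast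
  let ?t = "\<phi> (s \<otimes> x)"
  have t: "?t \<in> carrier R" using step \<phi>_closed by simp
  have "\<phi> (s \<otimes> (a [^] q \<otimes> T h \<oplus> \<phi> (y \<otimes> h) [^] q \<otimes> x)) = \<phi> ((a [^] q \<otimes> z \<oplus> ?t [^] q \<otimes> y) \<otimes> h)"
    if h: "h \<in> carrier R" for h
  proof -
    have c: "T h \<in> carrier R" "\<phi> (y \<otimes> h) \<in> carrier R"
      using step h trace_operator_closed \<phi>_closed by simp_all
    have "s \<otimes> (a [^] q \<otimes> T h \<oplus> \<phi> (y \<otimes> h) [^] q \<otimes> x) = a [^] q \<otimes> (s \<otimes> T h) \<oplus> \<phi> (y \<otimes> h) [^] q \<otimes> (s \<otimes> x)"
      using step c by (simp add: r_distr m_lcomm)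
    then have "\<phi> (s \<otimes> (a [^] q \<otimes> T h \<oplus> \<phi> (y \<otimes> h) [^] q \<otimes> x)) = a \<otimes> \<phi> (s \<otimes> T h) \<oplus> \<phi> (y \<otimes> h) \<otimes> ?t"
      using step c by (simp add: \<phi>_add \<phi>_linear)
    also have "\<dots> = a \<otimes> \<phi> (z \<otimes> h) \<oplus> ?t \<otimes> \<phi> (y \<otimes> h)"
      using z(2)[OF h] c t by (simp add: m_comm)
    also have "\<dots> = \<phi> (a [^] q \<otimes> (z \<otimes> h) \<oplus> ?t [^] q \<otimes> (y \<otimes> h))"
      using step z h t by (simp add: \<phi>_add \<phi>_linear)
    also have "a [^] q \<otimes> (z \<otimes> h) \<oplus> ?t [^] q \<otimes> (y \<otimes> h) = (a [^] q \<otimes> z \<oplus> ?t [^] q \<otimes> y) \<otimes> h"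
      using step z h t by (simp add: l_distr m_assoc)
    finally show ?thesis .
  qed
  then show ?case using step z t by (intro bexI[of _ "a [^] q \<otimes> z \<oplus> ?t [^] q \<otimes> y"]) simp_all
qed

text \<open>If \<open>h\<close> is in the \<open>\<phi>\<close>-stable ideal \<open>P\<close>, all the values \<open>\<phi>(y h)\<close> are in \<open>P\<close>, and each enters \<open>T h\<close> with
  exponent \<open>q \<ge> 2\<close>.\<close>

lemma trace_operator_square:
  assumes "ideal P R" "\<phi> ` P \<subseteq> P" "h \<in> P"
  shows "trace_operator e \<phi> T \<Longrightarrow> T h \<in> P \<cdot> P"
proof (induction rule: trace_operator.induct)
  interpret P: ideal P R by fact
  interpret PP: ideal "P \<cdot> P" R by (rule ideal_prod_is_ideal[OF assms(1) assms(1)])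
  case zero
  show ?case by simp
next
  interpret P: ideal P R by fact
  interpret PP: ideal "P \<cdot> P" R by (rule ideal_prod_is_ideal[OF assms(1) assms(1)])
  case (step T a x y)
  let ?u = "\<phi> (y \<otimes> h)"
  have u: "?u \<in> P" using P.I_l_closed[OF assms(3) step(4)] assms(2) by blast
  then have uc: "?u \<in> carrier R" by (rule P.Icarr)
  have "2 \<le> p" using prime_ge_2_nat[OF prime_p] .
  also have "p \<le> q" using self_le_power[of p e] e_pos \<open>2 \<le> p\<close> by simp
  finally obtain n where "q = Suc (Suc n)" by (metis Suc_le_D Suc_le_mono numeral_2_eq_2)
  then have "?u [^] q \<otimes> x = (x \<otimes> ?u [^] n) \<otimes> (?u \<otimes> ?u)" using uc step by (simp add: m_ac)
  moreover have "?u \<otimes> ?u \<in> P \<cdot> P" using u by (intro ideal_prod.prod)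
  ultimately have "?u [^] q \<otimes> x \<in> P \<cdot> P" using uc step by (simp add: PP.I_l_closed)
  moreover have "a [^] q \<otimes> T h \<in> P \<cdot> P" using step by (simp add: PP.I_l_closed)
  ultimately show ?case by (simp add: PP.a_closed)
qed

context
  fixes Q
  assumes Q: "primeideal Q R" and \<phi>_Q: "\<phi> ` Q \<subseteq> Q" and \<phi>_one: "\<phi> \<one> \<notin> Q"
begin

interpretation Q: primeideal Q R by (rule Q)

text \<open>Modulo \<open>Q\<close>, some trace operator is multiplication by \<open>c\<^sup>q\<close>, for some \<open>c \<notin> Q\<close>, on any given finite set. To add
  an element \<open>f\<close> to the set, consider the defect \<open>f' = c\<^sup>q f - T f\<close>. If it is not in \<open>Q\<close>, put
  \<open>s = f'\<^sup>q\<^sup>-\<^sup>1\<close>; the functional \<open>h \<mapsto> \<phi>(s (c\<^sup>q h - T h))\<close> vanishes modulo \<open>Q\<close> on the old elements, has the value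
  \<open>\<epsilon> = \<phi>(f'\<^sup>q) = f' \<phi>(1) \<notin> Q\<close> at \<open>f\<close>, and by the adjoint has the form \<open>h \<mapsto> \<phi>(y h)\<close>. Hence
  \<open>\<epsilon>\<^sup>q T h + \<phi>(y h)\<^sup>q f'\<close> is a trace operator that acts as \<open>(\<epsilon> c)\<^sup>q\<close> on the old elements and on \<open>f\<close>.\<close>

lemma trace_operator_scalar_on_finite:
  assumes "finite G" "G \<subseteq> carrier R"
  shows "\<exists>T c. trace_operator e \<phi> T \<and> c \<in> carrier R - Q \<and> (\<forall>g \<in> G. c [^] q \<otimes> g \<ominus> T g \<in> Q)"
  using assms
proof (induction G rule: finite_induct)
  case empty
  have "\<one> \<in> carrier R - Q" using Q.one_imp_carrier Q.I_notcarr by auto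
  then show ?case using trace_operator.zero by blast
next
  case (insert f G)
  then obtain T c where T: "trace_operator e \<phi> T" and c: "c \<in> carrier R - Q"
    and G: "\<And>g. g \<in> G \<Longrightarrow> c [^] q \<otimes> g \<ominus> T g \<in> Q" by auto
  have f: "f \<in> carrier R" and GR: "G \<subseteq> carrier R" using insert.prems by auto
  note Tc = trace_operator_closed[OF T]
  let ?f = "c [^] q \<otimes> f \<ominus> T f"
  have f': "?f \<in> carrier R" using f c Tc by simp
  show ?case
  proof (cases "?f \<in> Q")
    case True
    then show ?thesis using T c G by blast
  next
    case False
    define s where "s = ?f [^] (q - 1)"
    have s: "s \<in> carrier R" using f' by (simp add: s_def)
    obtain z where z: "z \<in> carrier R" "\<And>h. h \<in> carrier R \<Longrightarrow> \<phi> (s \<otimes> T h) = \<phi> (z \<otimes> h)"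
      using trace_operator_adjoint[OF T s] by blast
    define y where "y = c [^] q \<otimes> s \<ominus> z"
    have y: "y \<in> carrier R" using c s z by (simp add: y_def)
    have y_eq: "\<phi> (y \<otimes> h) = \<phi> (s \<otimes> (c [^] q \<otimes> h \<ominus> T h))" if h: "h \<in> carrier R" for h
    proof -
      have "y \<otimes> h = (c [^] q \<otimes> s) \<otimes> h \<ominus> z \<otimes> h"
        using c s z h by (simp add: y_def minus_eq l_distr l_minus)
      moreover have "s \<otimes> (c [^] q \<otimes> h \<ominus> T h) = (c [^] q \<otimes> s) \<otimes> h \<ominus> s \<otimes> T h"
        using c s h Tc by (simp add: minus_eq l_distr r_distr l_minus r_minus m_ac)
      ultimately show ?thesis using c s z h Tc by (simp add: \<phi>_minus)
    qed
    define \<epsilon> where "\<epsilon> = \<phi> (y \<otimes> f)"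
    have "\<epsilon> = \<phi> (?f [^] q \<otimes> \<one>)" using y_eq[OF f] f' by (simp add: \<epsilon>_def s_def pow_q)
    also have "\<dots> = ?f \<otimes> \<phi> \<one>" using f' \<phi>_linear by blast
    finally have "\<epsilon> \<notin> Q" using Q.I_prime[OF f' \<phi>_closed[OF one_closed]] False \<phi>_one by auto
    moreover have ec: "\<epsilon> \<in> carrier R" using y f \<phi>_closed by (simp add: \<epsilon>_def)
    ultimately have \<epsilon>c: "\<epsilon> \<otimes> c \<in> carrier R - Q" using c Q.I_prime by blast
    \<comment> \<open>The rank-one correction repairs the defect at the new element and vanishes modulo \<open>Q\<close> on the old ones.\<close>
    let ?T = "\<lambda>h. \<epsilon> [^] q \<otimes> T h \<oplus> \<phi> (y \<otimes> h) [^] q \<otimes> ?f"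
    have "trace_operator e \<phi> ?T" by (rule trace_operator.step[OF T ec f' y])
    moreover have "(\<epsilon> \<otimes> c) [^] q \<otimes> g \<ominus> ?T g \<in> Q" if g: "g \<in> insert f G" for g
    proof -
      have gc: "g \<in> carrier R" using g f GR by blast
      have u: "\<phi> (y \<otimes> g) \<in> carrier R" using y gc \<phi>_closed by simp
      have cc: "c \<in> carrier R" using c by simp
      have *: "(\<epsilon> \<otimes> c) [^] q \<otimes> g \<ominus> ?T g
          = \<epsilon> [^] q \<otimes> (c [^] q \<otimes> g \<ominus> T g) \<ominus> \<phi> (y \<otimes> g) [^] q \<otimes> ?f"
        using ec cc gc Tc[OF gc] u f'
        by (simp add: nat_pow_distrib minus_eq r_distr r_minus minus_add m_assoc a_assoc)
      show ?thesis
      proof (cases "g = f")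
        case True
        have "(\<epsilon> \<otimes> c) [^] q \<otimes> g \<ominus> ?T g = \<zero>"
          unfolding * using True ec f' by (simp add: \<epsilon>_def[symmetric] minus_eq r_neg)
        then show ?thesis by simp
      next
        case False
        then have gG: "c [^] q \<otimes> g \<ominus> T g \<in> Q" using G g by blast
        then have "\<phi> (y \<otimes> g) \<in> Q"
          using y_eq[OF gc] \<phi>_Q Q.I_l_closed[OF gG s] by auto
        then have "\<phi> (y \<otimes> g) [^] q \<in> Q" using u by (simp add: pow_q Q.I_l_closed)
        then have "\<ominus> (\<phi> (y \<otimes> g) [^] q \<otimes> ?f) \<in> Q"
          using f' Q.I_r_closed Q.a_inv_closed by blast
        then show ?thesis
          unfolding * minus_eq[of "\<epsilon> [^] q \<otimes> (c [^] q \<otimes> g \<ominus> T g)"]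
          using Q.I_l_closed[OF gG, of "\<epsilon> [^] q"] ec by (intro Q.a_closed) simp_all
      qed
    qed
    ultimately show ?thesis using \<epsilon>c by blast
  qed
qed

lemma trace_operator_scalar:
  assumes "F_finite R p"
  shows "\<exists>T c. trace_operator e \<phi> T \<and> c \<in> carrier R - Q \<and> (\<forall>h \<in> carrier R. c [^] q \<otimes> h \<ominus> T h \<in> Q)"
proof -
  obtain G where G: "finite G" "G \<subseteq> carrier R" "power_generates R q G"
    using F_finite_power_generates[OF prime_p char_p assms] by blast
  obtain T c where T: "trace_operator e \<phi> T" and c: "c \<in> carrier R - Q"
    and on_G: "\<forall>g \<in> G. c [^] q \<otimes> g \<ominus> T g \<in> Q"
    using trace_operator_scalar_on_finite[OF G(1,2)] by blast
  have cc: "c \<in> carrier R" using c by simp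
  note Tc = trace_operator_closed[OF T]
  have "{h \<in> carrier R. c [^] q \<otimes> h \<ominus> T h \<in> Q} = carrier R" (is "?H = _")
  proof (rule power_generatesD[OF G(3)])
    show "\<zero> \<in> ?H"
      using cc trace_operator_add[OF T, of \<zero> \<zero>] Tc[OF zero_closed] by (simp add: minus_eq)
    show "g \<oplus> h \<in> ?H" if "g \<in> ?H" "h \<in> ?H" for g h
    proof -
      have "g \<in> carrier R" "h \<in> carrier R" using that by auto
      then have "c [^] q \<otimes> (g \<oplus> h) \<ominus> T (g \<oplus> h) = (c [^] q \<otimes> g \<ominus> T g) \<oplus> (c [^] q \<otimes> h \<ominus> T h)"
        using cc Tc by (simp add: trace_operator_add[OF T] minus_eq r_distr minus_add a_ac)
      then show ?thesis using that by simp
    qed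
    show "a [^] q \<otimes> h \<in> ?H" if a: "a \<in> carrier R" and h: "h \<in> ?H" for a h
    proof -
      have "h \<in> carrier R" using h by simp
      then have "c [^] q \<otimes> (a [^] q \<otimes> h) \<ominus> T (a [^] q \<otimes> h) = a [^] q \<otimes> (c [^] q \<otimes> h \<ominus> T h)"
        using a cc Tc by (simp add: trace_operator_linear[OF T] minus_eq r_distr r_minus m_lcomm)
      then show ?thesis using a h Q.I_l_closed by simp
    qed
    show "G \<subseteq> ?H" using G(2) on_G by blast
  qed blast
  then show ?thesis using T c by blast
qed

text \<open>For a \<open>\<phi>\<close>-stable prime \<open>P\<close> above \<open>Q\<close>, multiplication by \<open>c\<^sup>q\<close> agrees modulo \<open>Q\<close> with a trace
  operator, which maps \<open>P\<close> into its square. If \<open>c\<close> were outside \<open>P\<close>, then \<open>P = P\<^sup>2 + Q\<close> locally at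
  \<open>P\<close>, which forces \<open>P = Q\<close>. So one \<open>c\<close> outside \<open>Q\<close> lies in all the \<open>\<phi>\<close>-stable primes strictly above
  \<open>Q\<close>.\<close>

lemma element_in_larger_compatible_primes:
  assumes "F_finite R p" "noetherian_ring R"
  shows "\<exists>c \<in> carrier R - Q. \<forall>P. primeideal P R \<and> Q \<subseteq> P \<and> P \<noteq> Q \<and> \<phi> ` P \<subseteq> P \<longrightarrow> c \<in> P"
proof -
  obtain T c where T: "trace_operator e \<phi> T" and c: "c \<in> carrier R - Q"
    and scalar: "\<And>h. h \<in> carrier R \<Longrightarrow> c [^] q \<otimes> h \<ominus> T h \<in> Q"
    using trace_operator_scalar[OF assms(1)] by blast
  have "c \<in> P" if P: "primeideal P R" "Q \<subseteq> P" "P \<noteq> Q" "\<phi> ` P \<subseteq> P" for P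
  proof (rule ccontr)
    assume "c \<notin> P"
    interpret P: primeideal P R by fact
    have w: "c [^] q \<in> carrier R - P"
      using mult_subset.S_pow[OF P.mult_subset_complement] c \<open>c \<notin> P\<close> by blast
    have "\<exists>k \<in> Q. \<exists>y \<in> P \<cdot> P. c [^] q \<otimes> x = y \<oplus> k" if "x \<in> P" for x
    proof (intro bexI)
      have x: "x \<in> carrier R" using that P.Icarr by blast
      show "T x \<in> P \<cdot> P" by (rule trace_operator_square[OF P.is_ideal P(4) that T])
      show "c [^] q \<otimes> x \<ominus> T x \<in> Q" by (rule scalar[OF x])
      show "c [^] q \<otimes> x = T x \<oplus> (c [^] q \<otimes> x \<ominus> T x)"
        using x c trace_operator_closed[OF T x] by (simp add: minus_eq a_lcomm[of "T x"] r_neg)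
    qed
    from noetherian_ring.prime_eq_of_localized_idempotent[OF assms(2) is_cring P(1) Q P(2) w this]
    show False using P(3) by simp
  qed
  then show ?thesis using c by blast
qed

end

end

text \<open>Otherwise take \<open>J\<close> maximal among the ideals below infinitely many compatible primes of the locus.
  Only finitely many of those primes contain a given element outside \<open>J\<close>. Hence \<open>J\<close> is the
  intersection of the compatible primes above it, it is prime, and \<open>\<phi>(J)\<close> is in \<open>J\<close> for every \<open>\<phi>\<close>. But then a single element outside \<open>J\<close>
  lies in all of these primes other than \<open>J\<close>, of which there are infinitely many.\<close>

lemma finite_compatible_primes:
  assumes "noetherian_ring R" "Factorial_Ring.prime p" "has_char R p" "F_finite R p"
  shows "finite {Q \<in> F_pure_locus R p D. D_compatible R D Q}" (is "finite ?X")
proof (rule ccontr)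
  assume inf: "infinite ?X"
  interpret noetherian_ring R by fact
  have X: "primeideal Q R" "ideal Q R" if "Q \<in> ?X" for Q
    using that F_pure_locus_iff primeideal.axioms(1) by auto
  let ?F = "{J. ideal J R \<and> infinite {Q \<in> ?X. J \<subseteq> Q}}"
  have "{Q \<in> ?X. {\<zero>} \<subseteq> Q} = ?X"
    using additive_subgroup.zero_closed[OF ideal.axioms(1)[OF X(2)]] by blast
  then have zero_F: "{\<zero>} \<in> ?F" using inf zeroideal by simp
  obtain J where J: "ideal J R" "infinite {Q \<in> ?X. J \<subseteq> Q}"
    and max: "\<And>I. ideal I R \<Longrightarrow> infinite {Q \<in> ?X. I \<subseteq> Q} \<Longrightarrow> J \<subseteq> I \<Longrightarrow> I = J"
  proof (rule maximal_member_of_ideals[of ?F])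
    fix M assume M: "M \<in> ?F" "\<And>I. I \<in> ?F \<Longrightarrow> M \<subseteq> I \<Longrightarrow> I = M"
    show thesis by (rule that[of M]) (use M in blast)+
  qed (use zero_F in blast)+
  interpret J: ideal J R by fact
  let ?Y = "{Q \<in> ?X. J \<subseteq> Q}"
  obtain Q0 where Q0: "Q0 \<in> ?Y" using infinite_imp_nonempty[OF J(2)] by blast
  have finite_above: "finite {Q \<in> ?X. J \<subseteq> Q \<and> a \<in> Q}" if a: "a \<in> carrier R" "a \<notin> J" for a
  proof (rule ccontr)
    assume inf_a: "infinite {Q \<in> ?X. J \<subseteq> Q \<and> a \<in> Q}"
    have sub: "insert a J \<subseteq> carrier R" using a(1) J.Icarr by blast
    have "Idl (insert a J) \<subseteq> Q" if "Q \<in> ?X" "J \<subseteq> Q" "a \<in> Q" for Q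
      using genideal_minimal[OF X(2)[OF that(1)]] that(2,3) by simp
    then have "{Q \<in> ?X. J \<subseteq> Q \<and> a \<in> Q} \<subseteq> {Q \<in> ?X. Idl (insert a J) \<subseteq> Q}" by blast
    then have "infinite {Q \<in> ?X. Idl (insert a J) \<subseteq> Q}" by (rule infinite_super[OF _ inf_a])
    from max[OF genideal_ideal[OF sub] this] have "Idl (insert a J) = J"
      using genideal_self[OF sub] by simp
    then show False using genideal_self[OF sub] a(2) by simp
  qed
  have mem_J: "a \<in> J" if "a \<in> carrier R" "\<And>Q. Q \<in> ?Y \<Longrightarrow> a \<in> Q" for a
  proof (rule ccontr)
    assume "a \<notin> J"
    moreover have "{Q \<in> ?X. J \<subseteq> Q \<and> a \<in> Q} = ?Y" using that(2) by blast
    ultimately show False using finite_above[OF that(1)] J(2) by simp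
  qed
  have J_prime: "primeideal J R"
  proof (rule primeidealI[OF J(1) is_cring])
    show "carrier R \<noteq> J"
    proof -
      have "Q0 \<in> ?X" "J \<subseteq> Q0" using Q0 by simp_all
      then show ?thesis
        using primeideal.I_notcarr[OF X(1)] ideal.Icarr[OF X(2)] by blast
    qed
    fix a b assume ab: "a \<in> carrier R" "b \<in> carrier R" "a \<otimes> b \<in> J"
    show "a \<in> J \<or> b \<in> J"
    proof (rule ccontr)
      assume "\<not> ?thesis"
      then have "finite ({Q \<in> ?X. J \<subseteq> Q \<and> a \<in> Q} \<union> {Q \<in> ?X. J \<subseteq> Q \<and> b \<in> Q})"
        using finite_above ab by simp
      moreover have "a \<in> Q \<or> b \<in> Q" if "Q \<in> ?X" "J \<subseteq> Q" for Q
        using primeideal.I_prime[OF X(1)[OF that(1)] ab(1,2)] ab(3) that(2) by blast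
      then have "?Y \<subseteq> {Q \<in> ?X. J \<subseteq> Q \<and> a \<in> Q} \<union> {Q \<in> ?X. J \<subseteq> Q \<and> b \<in> Q}" by blast
      ultimately show False using J(2) finite_subset by blast
    qed
  qed
  obtain e \<phi> where e: "e > 0" and \<phi>: "\<phi> \<in> D e" and one: "\<phi> \<one> \<notin> Q0"
    using Q0 unfolding F_pure_locus_iff by blast
  have compat: "\<phi> ` Q \<subseteq> Q" if "Q \<in> ?X" for Q
    using that \<phi> unfolding D_compatible_def by simp
  have stable: "\<phi> ` J \<subseteq> J"
  proof (rule image_subsetI)
    fix x assume x: "x \<in> J"
    show "\<phi> x \<in> J"
    proof (rule mem_J)
      show "\<phi> x \<in> carrier R" using D_closed[OF \<phi>] J.Icarr[OF x] by blast
      show "\<phi> x \<in> Q" if "Q \<in> ?Y" for Q using that x compat[of Q] by blast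
    qed
  qed
  have "\<phi> \<one> \<notin> J" using one Q0 by blast
  from element_in_larger_compatible_primes[OF assms(2,3) e \<phi> J_prime stable this assms(4,1)]
  obtain c where c: "c \<in> carrier R - J"
    and all: "\<forall>P. primeideal P R \<and> J \<subseteq> P \<and> P \<noteq> J \<and> \<phi> ` P \<subseteq> P \<longrightarrow> c \<in> P"
    by (elim bexE)
  have "c \<in> Q" if "Q \<in> ?X" "J \<subseteq> Q" "Q \<noteq> J" for Q
    using all[rule_format, of Q] X(1)[OF that(1)] compat[OF that(1)] that(2,3) by simp
  then have "?Y \<subseteq> insert J {Q \<in> ?X. J \<subseteq> Q \<and> c \<in> Q}" by blast
  moreover have "finite {Q \<in> ?X. J \<subseteq> Q \<and> c \<in> Q}" using finite_above c by blast
  ultimately show False using J(2) finite_subset by blast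
qed

end

section \<open>Strong F-regularity\<close>

context cartier_algebra
begin

lemma F_pure_locus_eq_Spec:
  assumes "F_pure R D"
  shows "F_pure_locus R p D = Spec R"
proof -
  obtain e \<phi> where e: "e > 0" "\<phi> \<in> D e" "\<phi> \<one> = \<one>" using assms unfolding F_pure_def by blast
  have "\<phi> \<one> \<notin> P" if "primeideal P R" for P
    using primeideal.I_notcarr[OF that] ideal.one_imp_carrier[OF primeideal.axioms(1)[OF that]] e(3) by auto
  then show ?thesis using e(1,2) unfolding F_pure_locus_iff Spec_def set_eq_iff by auto
qed

text \<open>A splitting \<open>\<psi>\<close> of degree \<open>f\<close> raises degrees without changing the value \<open>a = \<phi> c\<close>, because
  \<open>\<psi>(a\<^sup>q\<^sup>-\<^sup>1 a) = a \<psi>(1) = a\<close> for \<open>q = p\<^sup>f\<close>.\<close>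

lemma value_in_higher_degree:
  assumes \<psi>: "\<psi> \<in> D f" "\<psi> \<one> = \<one>" and \<phi>: "\<phi> \<in> D d" and c: "c \<in> carrier R"
  shows "\<exists>\<chi> \<in> D (m * f + d). \<chi> c = \<phi> c"
proof (induction m)
  case 0
  show ?case using \<phi> by auto
next
  case (Suc m)
  then obtain \<chi> where \<chi>: "\<chi> \<in> D (m * f + d)" "\<chi> c = \<phi> c" by blast
  let ?a = "\<phi> c"
  have a: "?a \<in> carrier R" using D_closed[OF \<phi> c] .
  let ?\<psi> = "\<lambda>x \<in> carrier R. \<psi> (?a [^] (p ^ f - 1) \<otimes> x)"
  have "(\<lambda>x \<in> carrier R. ?\<psi> (\<chi> x)) \<in> D (f + (m * f + d))"
    using a by (intro D_compose[OF D_premult[OF \<psi>(1)] \<chi>(1)]) simp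
  moreover have "(\<lambda>x \<in> carrier R. ?\<psi> (\<chi> x)) c = ?a"
  proof -
    have "(\<lambda>x \<in> carrier R. ?\<psi> (\<chi> x)) c = \<psi> (?a [^] (p ^ f) \<otimes> \<one>)"
      using a c \<chi>(2) by (simp add: pow_q)
    also have "\<dots> = ?a \<otimes> \<one>" using D_linear[OF \<psi>(1) a one_closed] \<psi>(2) by simp
    finally show ?thesis using a by simp
  qed
  ultimately show ?case by (metis add.assoc mult_Suc)
qed

text \<open>Powers of a value of a map of degree \<open>e\<close> are values of maps whose degree is a multiple of \<open>e\<close>, so
  the degree of \<open>\<phi>\<close> can be made divisible by the degree of a given splitting at the cost of replacing
  the value by a power of it.\<close>

lemma power_of_value:
  assumes \<phi>: "\<phi> \<in> D e" and c: "c \<in> carrier R"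
  shows "\<exists>\<chi> \<in> D (Suc k * e). \<chi> c = \<phi> c [^] Suc k"
proof (induction k)
  case 0
  show ?case using \<phi> D_closed[OF \<phi> c] by auto
next
  case (Suc k)
  then obtain \<chi> where \<chi>: "\<chi> \<in> D (Suc k * e)" "\<chi> c = \<phi> c [^] Suc k" by blast
  let ?q = "p ^ (Suc k * e)" and ?a = "\<phi> c"
  have a: "?a \<in> carrier R" using D_closed[OF \<phi> c] .
  let ?\<chi> = "\<lambda>x \<in> carrier R. \<chi> ((?a [^] (?q - 1) \<otimes> c) \<otimes> x)"
  have "(\<lambda>x \<in> carrier R. ?\<chi> (\<phi> x)) \<in> D (Suc k * e + e)"
    using a c by (intro D_compose[OF D_premult[OF \<chi>(1)] \<phi>]) simp
  moreover have "(\<lambda>x \<in> carrier R. ?\<chi> (\<phi> x)) c = ?a [^] Suc (Suc k)"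
  proof -
    have "(?a [^] (?q - 1) \<otimes> c) \<otimes> ?a = ?a [^] ?q \<otimes> c"
      using a c by (simp only: pow_q m_ac nat_pow_closed m_closed)
    then have "(\<lambda>x \<in> carrier R. ?\<chi> (\<phi> x)) c = \<chi> (?a [^] ?q \<otimes> c)"
      using a c by simp
    also have "\<dots> = ?a \<otimes> ?a [^] Suc k" using D_linear[OF \<chi>(1) a c] \<chi>(2) by simp
    also have "\<dots> = ?a [^] Suc (Suc k)" using a by (simp add: m_ac)
    finally show ?thesis .
  qed
  moreover have "Suc (Suc k) * e = Suc k * e + e" by simp
  ultimately show ?case by metis
qed

text \<open>Let \<open>f\<close> be the degree of a splitting. The values at \<open>c\<close> of the maps of degree \<open>k f\<close>, for all
  \<open>k > 0\<close>, form an ideal, because raising degrees brings any two of these maps to a common degree. It is proper if no map sends \<open>c\<close>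
  to 1, and hence it is contained in a prime. That prime contains a power of \<open>\<phi> c\<close> for each \<open>\<phi>\<close> of positive degree.\<close>

lemma prime_core_containing_nonsplit_element:
  assumes "noetherian_ring R" "F_pure R D" "c \<in> carrier R" "\<not> F_pure_along R D c"
  shows "\<exists>P. primeideal P R \<and> c \<in> cartier_core R D P"
proof -
  obtain f \<psi> where f: "f > 0" and \<psi>: "\<psi> \<in> D f" "\<psi> \<one> = \<one>"
    using assms(2) unfolding F_pure_def by blast
  let ?I = "{\<phi> c | \<phi> k. k > 0 \<and> \<phi> \<in> D (k * f)}"
  have I: "ideal ?I R"
  proof (rule ideal_of_closed)
    show "?I \<subseteq> carrier R" using D_closed assms(3) by blast
    have "(\<lambda>x \<in> carrier R. \<psi> (\<zero> \<otimes> x)) \<in> D (1 * f)" using D_premult[OF \<psi>(1) zero_closed] by simp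
    moreover have "(\<lambda>x \<in> carrier R. \<psi> (\<zero> \<otimes> x)) c = \<zero>"
      using assms(3) D_zero[OF \<psi>(1)] by simp
    ultimately show "\<zero> \<in> ?I" by (metis (mono_tags, lifting) mem_Collect_eq zero_less_one)
  next
    fix a b assume "a \<in> ?I" "b \<in> ?I"
    then obtain \<phi> k \<phi>' k' where *: "k > 0" "\<phi> \<in> D (k * f)" "a = \<phi> c" "k' > 0" "\<phi>' \<in> D (k' * f)" "b = \<phi>' c"
      by blast
    obtain \<chi> where \<chi>: "\<chi> \<in> D (k' * f + k * f)" "\<chi> c = a"
      using value_in_higher_degree[OF \<psi> *(2) assms(3), of k'] *(3) by blast
    obtain \<chi>' where \<chi>': "\<chi>' \<in> D (k * f + k' * f)" "\<chi>' c = b"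
      using value_in_higher_degree[OF \<psi> *(5) assms(3), of k] *(6) by blast
    have eq: "k' * f + k * f = (k + k') * f" "k * f + k' * f = (k + k') * f" by (simp_all add: add_mult_distrib)
    have "(\<lambda>x \<in> carrier R. \<chi> x \<oplus> \<chi>' x) \<in> D ((k + k') * f)"
      using D_sum \<chi>(1) \<chi>'(1) unfolding eq by blast
    moreover have "(\<lambda>x \<in> carrier R. \<chi> x \<oplus> \<chi>' x) c = a \<oplus> b" using assms(3) \<chi>(2) \<chi>'(2) by simp
    moreover have "k + k' > 0" using *(1) by simp
    ultimately show "a \<oplus> b \<in> ?I" by (metis (mono_tags, lifting) mem_Collect_eq)
  next
    fix a x assume "a \<in> ?I" and x: "x \<in> carrier R"
    then obtain \<phi> k where *: "k > 0" "\<phi> \<in> D (k * f)" "a = \<phi> c" by blast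
    let ?\<chi> = "\<lambda>y \<in> carrier R. \<phi> (x [^] (p ^ (k * f)) \<otimes> y)"
    have "?\<chi> \<in> D (k * f)" using D_premult[OF *(2)] x by simp
    moreover have "?\<chi> c = x \<otimes> a" using D_linear[OF *(2) x assms(3)] assms(3) *(3) by simp
    ultimately show "x \<otimes> a \<in> ?I" using *(1) by (metis (mono_tags, lifting) mem_Collect_eq)
  qed
  have "\<one> \<notin> ?I"
  proof
    assume "\<one> \<in> ?I"
    then obtain \<phi> k where "\<one> = \<phi> c" "k > 0" "\<phi> \<in> D (k * f)" by blast
    then show False using assms(4) f unfolding F_pure_along_def by (metis nat_0_less_mult_iff)
  qed
  from noetherian_ring.prime_containing_proper_ideal[OF assms(1) is_cring I this]
  obtain P where P: "primeideal P R" "?I \<subseteq> P" by blast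
  interpret P: primeideal P R by (rule P(1))
  have "\<phi> c \<in> P" if e: "e > 0" "\<phi> \<in> D e" for e \<phi>
  proof (rule ccontr)
    assume "\<phi> c \<notin> P"
    obtain k where k: "f = Suc k" using f by (cases f) auto
    obtain \<chi> where \<chi>: "\<chi> \<in> D (f * e)" "\<chi> c = \<phi> c [^] f"
      using power_of_value[OF e(2) assms(3), of k] unfolding k[symmetric] by blast
    have "\<chi> \<in> D (e * f)" using \<chi>(1) by (simp only: mult.commute)
    then have "\<phi> c [^] f \<in> ?I" using e(1) \<chi>(2)[symmetric] by blast
    moreover have "\<phi> c \<in> carrier R - P" using \<open>\<phi> c \<notin> P\<close> D_closed[OF e(2) assms(3)] by simp
    then have "\<phi> c [^] f \<in> carrier R - P" by (rule mult_subset.S_pow[OF P.mult_subset_complement])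
    ultimately show False using P(2) by blast
  qed
  then show ?thesis using P(1) assms(3) core_iff by blast
qed

text \<open>If the pair is strongly F-regular, a compatible prime contains no element that some map sends to 1, so
  it is contained in the union of the minimal primes, which are finitely many as they are fixed by the
  core map. Conversely, if \<open>c\<close> could not be split, it would lie in the core of some prime, and that core
  is a minimal prime by hypothesis.\<close>

lemma strongly_F_regular_iff:
  assumes noeth: "noetherian_ring R" and fin: "finite (cartier_core R D ` F_pure_locus R p D)"
  shows "strongly_F_regular R D \<longleftrightarrow>
    F_pure R D \<and> cartier_core R D ` F_pure_locus R p D = minimal_primes R"
proof
  assume sfr: "strongly_F_regular R D"
  have "\<one> \<notin> P" if "P \<in> minimal_primes R" for P
  proof -
    have "primeideal P R" using that unfolding minimal_primes_def Spec_def by simp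
    then show ?thesis
      using primeideal.I_notcarr ideal.one_imp_carrier[OF primeideal.axioms(1)] by metis
  qed
  then have "F_pure_along R D \<one>" using sfr one_closed unfolding strongly_F_regular_def by blast
  then have pure: "F_pure R D" unfolding F_pure_def F_pure_along_def .
  note U = F_pure_locus_eq_Spec[OF pure]
  have min_sub: "minimal_primes R \<subseteq> cartier_core R D ` F_pure_locus R p D"
  proof
    fix P assume P: "P \<in> minimal_primes R"
    then have PU: "P \<in> F_pure_locus R p D" unfolding U minimal_primes_def by simp
    have "cartier_core R D P = P"
      using P core_prime[OF PU] core_subset[OF PU] unfolding minimal_primes_def Spec_def by simp
    then show "P \<in> cartier_core R D ` F_pure_locus R p D" using PU by (metis image_eqI)
  qed
  moreover have "cartier_core R D ` F_pure_locus R p D \<subseteq> minimal_primes R"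
  proof
    fix Q assume "Q \<in> cartier_core R D ` F_pure_locus R p D"
    then have Q: "Q \<in> Spec R" "D_compatible R D Q" unfolding core_image unfolding U by simp_all
    have Qi: "ideal Q R" using Q(2) unfolding D_compatible_def by simp
    show "Q \<in> minimal_primes R"
    proof (rule ccontr)
      assume "Q \<notin> minimal_primes R"
      then have not_sub: "\<not> Q \<subseteq> P" if "P \<in> minimal_primes R" for P
        using that Q(1) unfolding minimal_primes_def by blast
      have "\<exists>c \<in> Q. \<forall>P \<in> minimal_primes R. c \<notin> P"
      proof (rule avoid_incomparable_primes)
        show "finite (minimal_primes R)" by (rule finite_subset[OF min_sub fin])
        show "primeideal P R" if "P \<in> minimal_primes R" for P
          using that unfolding minimal_primes_def Spec_def by simp
        show "P' = P" if "P \<in> minimal_primes R" "P' \<in> minimal_primes R" "P' \<subseteq> P" for P P'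
          using that unfolding minimal_primes_def by simp
      qed (use Qi not_sub in auto)
      then obtain c where c: "c \<in> Q" "\<forall>P \<in> minimal_primes R. c \<notin> P" by blast
      then have "F_pure_along R D c"
        using sfr ideal.Icarr[OF Qi c(1)] unfolding strongly_F_regular_def by blast
      then obtain e \<phi> where "\<phi> \<in> D e" "\<phi> c = \<one>" unfolding F_pure_along_def by blast
      moreover from this have "\<phi> c \<in> Q" using Q(2) c(1) unfolding D_compatible_def by blast
      ultimately have "\<one> \<in> Q" by simp
      then show False
        using Q(1) ideal.one_imp_carrier[OF Qi] primeideal.I_notcarr[of Q R] unfolding Spec_def by simp
    qed
  qed
  ultimately show "F_pure R D \<and> cartier_core R D ` F_pure_locus R p D = minimal_primes R"
    using pure by blast
next
  assume R: "F_pure R D \<and> cartier_core R D ` F_pure_locus R p D = minimal_primes R"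
  show "strongly_F_regular R D"
    unfolding strongly_F_regular_def
  proof (intro ballI impI)
    fix c assume c: "c \<in> carrier R" "\<forall>P \<in> minimal_primes R. c \<notin> P"
    show "F_pure_along R D c"
    proof (rule ccontr)
      assume "\<not> F_pure_along R D c"
      then obtain P where P: "primeideal P R" "c \<in> cartier_core R D P"
        using prime_core_containing_nonsplit_element[OF noeth _ c(1)] R by blast
      then have "P \<in> F_pure_locus R p D"
        using F_pure_locus_eq_Spec R unfolding Spec_def by blast
      then have "cartier_core R D P \<in> minimal_primes R" using R by blast
      then show False using c(2) P(2) by blast
    qed
  qed
qed

end

theorem theoremA:
  fixes R :: "('a, 'm) ring_scheme"
    and p :: nat
    and D :: "nat \<Rightarrow> ('a \<Rightarrow> 'a) set"
  assumes "cring R" and "noetherian_ring R"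
    and "Factorial_Ring.prime p" and "has_char R p"
    and "F_finite R p"
    and "cartier_subalgebra R p D"
  shows "cartier_core R D \<in> F_pure_locus R p D \<rightarrow> Spec R
    \<and> continuous_map (subtopology (zariski R) (F_pure_locus R p D)) (zariski R) (cartier_core R D)
    \<and> (\<forall>P1 \<in> F_pure_locus R p D. \<forall>P2 \<in> F_pure_locus R p D.
         P1 \<subseteq> P2 \<longrightarrow> cartier_core R D P1 \<subseteq> cartier_core R D P2)
    \<and> (\<forall>P \<in> F_pure_locus R p D. D_compatible R D P \<longrightarrow> cartier_core R D P = P)
    \<and> cartier_core R D ` F_pure_locus R p D = {Q \<in> F_pure_locus R p D. D_compatible R D Q}
    \<and> finite (cartier_core R D ` F_pure_locus R p D)
    \<and> (strongly_F_regular R D \<longleftrightarrow>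
         F_pure R D \<and> cartier_core R D ` F_pure_locus R p D = minimal_primes R)"
proof -
  interpret cring R by fact
  interpret cartier_algebra R p D
    by unfold_locales (use prime_gt_0_nat[OF assms(3)] assms(6) in simp_all)
  have fin: "finite (cartier_core R D ` F_pure_locus R p D)"
    unfolding core_image by (rule finite_compatible_primes[OF assms(2-5)])
  show ?thesis
  proof (intro conjI ballI impI)
    show "cartier_core R D \<in> F_pure_locus R p D \<rightarrow> Spec R"
      using core_prime by (simp add: Spec_def)
    show "cartier_core R D P1 \<subseteq> cartier_core R D P2" if "P1 \<subseteq> P2" for P1 P2
      using that unfolding cartier_core_def by blast
    show "cartier_core R D P = P" if "P \<in> F_pure_locus R p D" "D_compatible R D P" for P
      by (rule core_fixes_compatible[OF that])
  qed (rule core_continuous core_image fin strongly_F_regular_iff[OF assms(2) fin])+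
qed

end
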